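(* Let $\varkappa\in\{1,-1\}$ and $p=(1+\varkappa)/2$. Let $v_t(x,t)$ be continuous in $D$, and let the scalar functions $\rho$ and $v$ satisfy in $D$ the complex coupled dispersionless equations $$\rho_x+\tfrac12\varkappa\big(|v|^2\big)_t=0,\qquad v_{tx}=\rho v\qquad(\rho=\overline\rho).$$ Let $n\in\mathbb N$, let $A$ and $S(0,0)=S(0,0)^*$ be complex $n\times n$ matrices and $\Pi(0,0)$ a complex $n\times2$ matrix such that $$AS(0,0)-S(0,0)A^*=\mathrm i\,\Pi(0,0)j^{p+1}\Pi(0,0)^*\qquad(\det A\ne0,\ \det S(0,0)\ne0),$$ and let $\Pi(x,t)$ and $S(x,t)$ be determined by these initial values and the linear systems of the context. Then, at the points of $D$ where $S(x,t)$ is invertible, the functions $$\widetilde\rho=\mathrm i\begin{bmatrix}0&1\end{bmatrix}\widetilde Q_{-1}\begin{bmatrix}0\\1\end{bmatrix},\qquad \widetilde v=v+\mathrm i\,\Phi_1^*S^{-1}\Phi_2$$ satisfy $$\widetilde\rho_x+\tfrac12\varkappa\big(|\widetilde v|^2\big)_t=0,\qquad \widetilde v_{tx}=\widetilde\rho\,\widetilde v\qquad(\widetilde\rho=\overline{\widetilde\rho}).$$ Moreover, for $\lambda\ne0$, a wave function $w(x,t,\lambda)$ ($\det w(0,0,\lambda)\ne0$) is well defined in $D$ as a $2\times 2$ solution of the auxiliary systems $$w_x=Gw,\quad G=\tfrac{\mathrm i}4\lambda j-\tfrac{\mathrm i}2j^{p+1}V;\qquad w_t=Fw,\quad F=\tfrac1\lambda\big(-\mathrm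 i\rho j+j^pV_t\big).$$ The wave function $\widetilde w$ ($\det\widetilde w(0,0,\lambda)\ne0$) corresponding to the transformed equations (i.e. to the auxiliary systems with $\widetilde\rho,\widetilde v$ in place of $\rho,v$) is given by $\widetilde w=w_A\,w$, where $$w_A(x,t,\lambda)=I_2-\mathrm i j^{p+1}\Pi(x,t)^*S(x,t)^{-1}(A-\lambda I_n)^{-1}\Pi(x,t)\qquad(\lambda\notin\{0\}\cup\sigma(A)\cup\sigma(A^* )).$$
   Context: Notation. $v$ is a complex-valued and $\rho$ a real-valued function on $D=\{(x,t):\ a_1<x<a_2,\ b_1<t<b_2\}$, where $-\infty\le a_1<0<a_2\le\infty$, $-\infty\le b_1<0<b_2\le\infty$. Subscripts $x,t$ denote partial derivatives, $\overline{\,\cdot\,}$ is complex conjugation, $^*$ is the conjugate transpose, $\sigma(\cdot)$ is the spectrum. $$j=\begin{bmatrix}1&0\\0&-1\end{bmatrix},\quad V=\begin{bmatrix}0&v\\ \overline v&0\end{bmatrix},\quad q_1=-\tfrac{\mathrm i}4j,\quad q_0=\tfrac{\mathrm i}2j^{p+1}V,\quad Q_{-1}=\mathrm i\rho j-j^pV_t.$$ Linear systems: $$\Pi_x=A\Pi q_1+\Pi q_0,\quad \Pi_t=A^{-1}\Pi Q_{-1},\quad S_x=\mathrm i\,\Pi q_1j^{p+1}\Pi^*,\quad S_t=-\mathrm i A^{-1}\Pi Q_{-1}j^{p+1}\Pi^*(A^* )^{-1}.$$ $\Pi=[\Phi_1\ \ \Phi_2]$ is the partition of $\Pi$ into its two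 $n\times1$ columns. At points where $S$ is invertible, $$X_{-1}=\mathrm i j^{p+1}\Pi^*S^{-1}A^{-1}\Pi,\quad Y_{-1}=\mathrm i j^{p+1}\Pi^*(A^* )^{-1}S^{-1}\Pi,\quad \widetilde Q_{-1}=(I_2-X_{-1})Q_{-1}(I_2+Y_{-1}).$$ A wave function is a $2\times 2$ matrix solution, with nonzero determinant at $(0,0)$, of the associated pair of auxiliary linear systems.
   Formalization: The functions v and ρ are additionally assumed jointly continuous in D; with only v_t continuous, ρ = 0 and v = v(x) with a jump at x = 0 satisfy the equations, but w_x = Gw then has no solution with nonzero determinant at (0,0). *)

theory Defs
  imports "HOL-Analysis.Analysis"
begin

text \<open>Functions on the plane are curried, \<open>f x t\<close>; their values off the set under consideration
  are irrelevant.\<close>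

definition open_box :: "ereal \<Rightarrow> ereal \<Rightarrow> ereal \<Rightarrow> ereal \<Rightarrow> (real \<times> real) set" where
  "open_box a1 a2 b1 b2 = {(x, t). a1 < ereal x \<and> ereal x < a2 \<and> b1 < ereal t \<and> ereal t < b2}"

definition dx :: "(real \<Rightarrow> real \<Rightarrow> 'a::real_normed_vector) \<Rightarrow> real \<Rightarrow> real \<Rightarrow> 'a" where
  "dx f x t = vector_derivative (\<lambda>s. f s t) (at x)"

definition dt :: "(real \<Rightarrow> real \<Rightarrow> 'a::real_normed_vector) \<Rightarrow> real \<Rightarrow> real \<Rightarrow> 'a" where
  "dt f x t = vector_derivative (\<lambda>s. f x s) (at t)"

text \<open>\<^const>\<open>vector_derivative\<close> is unspecified where the derivative does not exist, so
  the existence of every partial derivative in the equations is required separately.\<close>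

definition ccd_solution ::
    "real \<Rightarrow> (real \<times> real) set \<Rightarrow> (real \<Rightarrow> real \<Rightarrow> complex) \<Rightarrow> (real \<Rightarrow> real \<Rightarrow> complex) \<Rightarrow> bool" where
  "ccd_solution \<kappa> \<Omega> \<rho> v \<longleftrightarrow>
    (\<forall>(x, t) \<in> \<Omega>.
       (\<lambda>s. \<rho> s t) differentiable at x \<and>
       (\<lambda>s. (cmod (v x s))\<^sup>2) differentiable at t \<and>
       (\<lambda>s. v x s) differentiable at t \<and>
       (\<lambda>s. dt v s t) differentiable at x \<and>
       dx \<rho> x t + of_real (\<kappa> / 2 * dt (\<lambda>x t. (cmod (v x t))\<^sup>2) x t) = 0 \<and>
       dx (dt v) x t = \<rho> x t * v x t \<and>
       \<rho> x t = cnj (\<rho> x t))"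

definition conj_transpose :: "complex^'n^'m \<Rightarrow> complex^'m^'n"  ("_\<^sup>H" [1000] 999) where
  "M\<^sup>H = (\<chi> i k. cnj (M $ k $ i))"

definition cscale :: "complex \<Rightarrow> complex^'n^'m \<Rightarrow> complex^'n^'m"  (infixr "*\<^sub>m" 75) where
  "c *\<^sub>m M = (\<chi> i k. c * M $ i $ k)"

text \<open>The type class operations \<open>*\<close> and \<open>^\<close> act entrywise on matrices, hence a separate power.\<close>

definition matrix_power :: "complex^'n^'n \<Rightarrow> nat \<Rightarrow> complex^'n^'n" where
  "matrix_power M k = (((**) M) ^^ k) (mat 1)"

definition spectrum :: "complex^'n^'n \<Rightarrow> complex set" where
  "spectrum M = {\<mu>. \<not> invertible (M - mat \<mu>)}"

definition jmat :: "complex^2^2" where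
  "jmat = vector [vector [1, 0], vector [0, -1]]"

abbreviation jpow :: "nat \<Rightarrow> complex^2^2" where
  "jpow k \<equiv> matrix_power jmat k"

text \<open>\<open>Vmat z\<close> is the matrix \<open>V\<close> for the value \<open>v = z\<close>; as the derivative in \<open>t\<close>
  commutes with conjugation, \<open>Vmat (dt v x t)\<close> is the derivative of \<open>V\<close> in \<open>t\<close>.\<close>

definition Vmat :: "complex \<Rightarrow> complex^2^2" where
  "Vmat z = vector [vector [0, z], vector [cnj z, 0]]"

definition q1 :: "complex^2^2" where
  "q1 = (- \<i> / 4) *\<^sub>m jmat"

definition q0 :: "nat \<Rightarrow> (real \<Rightarrow> real \<Rightarrow> complex) \<Rightarrow> real \<Rightarrow> real \<Rightarrow> complex^2^2" where
  "q0 p v x t = (\<i> / 2) *\<^sub>m (jpow (p + 1) ** Vmat (v x t))"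

definition Qm1 ::
    "nat \<Rightarrow> (real \<Rightarrow> real \<Rightarrow> complex) \<Rightarrow> (real \<Rightarrow> real \<Rightarrow> complex) \<Rightarrow> real \<Rightarrow> real \<Rightarrow> complex^2^2" where
  "Qm1 p \<rho> v x t = (\<i> * \<rho> x t) *\<^sub>m jmat - jpow p ** Vmat (dt v x t)"

text \<open>The matrix functions written with a capital Pi in the mathematics are called \<open>P\<close> here.\<close>

definition linear_systems ::
    "nat \<Rightarrow> (real \<times> real) set \<Rightarrow> (real \<Rightarrow> real \<Rightarrow> complex) \<Rightarrow> (real \<Rightarrow> real \<Rightarrow> complex) \<Rightarrow>
     complex^'n^'n \<Rightarrow> (real \<Rightarrow> real \<Rightarrow> complex^2^'n) \<Rightarrow> (real \<Rightarrow> real \<Rightarrow> complex^'n^'n) \<Rightarrow> bool" where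
  "linear_systems p D \<rho> v A P S \<longleftrightarrow>
    (\<forall>(x, t) \<in> D.
       ((\<lambda>s. P s t) has_vector_derivative (A ** P x t ** q1 + P x t ** q0 p v x t)) (at x) \<and>
       ((\<lambda>s. P x s) has_vector_derivative (matrix_inv A ** P x t ** Qm1 p \<rho> v x t)) (at t) \<and>
       ((\<lambda>s. S s t) has_vector_derivative
          (\<i> *\<^sub>m (P x t ** q1 ** jpow (p + 1) ** (P x t)\<^sup>H))) (at x) \<and>
       ((\<lambda>s. S x s) has_vector_derivative
          ((- \<i>) *\<^sub>m (matrix_inv A ** P x t ** Qm1 p \<rho> v x t ** jpow (p + 1) ** (P x t)\<^sup>H
             ** matrix_inv (A\<^sup>H)))) (at t))"

definition Xm1 :: "nat \<Rightarrow> complex^'n^'n \<Rightarrow> complex^2^'n \<Rightarrow> complex^'n^'n \<Rightarrow> complex^2^2" where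
  "Xm1 p A P S = \<i> *\<^sub>m (jpow (p + 1) ** P\<^sup>H ** matrix_inv S ** matrix_inv A ** P)"

definition Ym1 :: "nat \<Rightarrow> complex^'n^'n \<Rightarrow> complex^2^'n \<Rightarrow> complex^'n^'n \<Rightarrow> complex^2^2" where
  "Ym1 p A P S = \<i> *\<^sub>m (jpow (p + 1) ** P\<^sup>H ** matrix_inv (A\<^sup>H) ** matrix_inv S ** P)"

definition Qm1_transformed ::
    "nat \<Rightarrow> (real \<Rightarrow> real \<Rightarrow> complex) \<Rightarrow> (real \<Rightarrow> real \<Rightarrow> complex) \<Rightarrow> complex^'n^'n \<Rightarrow>
     (real \<Rightarrow> real \<Rightarrow> complex^2^'n) \<Rightarrow> (real \<Rightarrow> real \<Rightarrow> complex^'n^'n) \<Rightarrow>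
     real \<Rightarrow> real \<Rightarrow> complex^2^2" where
  "Qm1_transformed p \<rho> v A P S x t =
     (mat 1 - Xm1 p A (P x t) (S x t)) ** Qm1 p \<rho> v x t ** (mat 1 + Ym1 p A (P x t) (S x t))"

definition rho_transformed ::
    "nat \<Rightarrow> (real \<Rightarrow> real \<Rightarrow> complex) \<Rightarrow> (real \<Rightarrow> real \<Rightarrow> complex) \<Rightarrow> complex^'n^'n \<Rightarrow>
     (real \<Rightarrow> real \<Rightarrow> complex^2^'n) \<Rightarrow> (real \<Rightarrow> real \<Rightarrow> complex^'n^'n) \<Rightarrow>
     real \<Rightarrow> real \<Rightarrow> complex" where
  "rho_transformed p \<rho> v A P S x t = \<i> * Qm1_transformed p \<rho> v A P S x t $ 2 $ 2"

definition v_transformed ::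
    "(real \<Rightarrow> real \<Rightarrow> complex) \<Rightarrow>
     (real \<Rightarrow> real \<Rightarrow> complex^2^'n) \<Rightarrow> (real \<Rightarrow> real \<Rightarrow> complex^'n^'n) \<Rightarrow>
     real \<Rightarrow> real \<Rightarrow> complex" where
  "v_transformed v P S x t =
     v x t + \<i> * (\<Sum>k\<in>UNIV. cnj (column 1 (P x t) $ k) * (matrix_inv (S x t) *v column 2 (P x t)) $ k)"

definition Gmat :: "nat \<Rightarrow> complex \<Rightarrow> (real \<Rightarrow> real \<Rightarrow> complex) \<Rightarrow> real \<Rightarrow> real \<Rightarrow> complex^2^2" where
  "Gmat p lam v x t = (\<i> / 4 * lam) *\<^sub>m jmat - (\<i> / 2) *\<^sub>m (jpow (p + 1) ** Vmat (v x t))"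

definition Fmat ::
    "nat \<Rightarrow> complex \<Rightarrow> (real \<Rightarrow> real \<Rightarrow> complex) \<Rightarrow> (real \<Rightarrow> real \<Rightarrow> complex) \<Rightarrow>
     real \<Rightarrow> real \<Rightarrow> complex^2^2" where
  "Fmat p lam \<rho> v x t = (1 / lam) *\<^sub>m ((- \<i> * \<rho> x t) *\<^sub>m jmat + jpow p ** Vmat (dt v x t))"

definition wave_function ::
    "nat \<Rightarrow> complex \<Rightarrow> (real \<times> real) set \<Rightarrow> (real \<Rightarrow> real \<Rightarrow> complex) \<Rightarrow>
     (real \<Rightarrow> real \<Rightarrow> complex) \<Rightarrow> (real \<Rightarrow> real \<Rightarrow> complex^2^2) \<Rightarrow> bool" where
  "wave_function p lam \<Omega> \<rho> v w \<longleftrightarrow>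
    (0, 0) \<in> \<Omega> \<and> det (w 0 0) \<noteq> 0 \<and>
    (\<forall>(x, t) \<in> \<Omega>.
       ((\<lambda>s. w s t) has_vector_derivative (Gmat p lam v x t ** w x t)) (at x) \<and>
       ((\<lambda>s. w x s) has_vector_derivative (Fmat p lam \<rho> v x t ** w x t)) (at t))"

definition darboux_matrix ::
    "nat \<Rightarrow> complex^'n^'n \<Rightarrow> (real \<Rightarrow> real \<Rightarrow> complex^2^'n) \<Rightarrow>
     (real \<Rightarrow> real \<Rightarrow> complex^'n^'n) \<Rightarrow> complex \<Rightarrow> real \<Rightarrow> real \<Rightarrow> complex^2^2" where
  "darboux_matrix p A P S lam x t =
     mat 1 - \<i> *\<^sub>m (jpow (p + 1) ** (P x t)\<^sup>H ** matrix_inv (S x t) **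
                     matrix_inv (A - mat lam) ** P x t)"

end

theory Submission
  imports Defs
begin

text \<open>Write \<open>J = j^(p+1) = diag(1, \<kappa>)\<close>, \<open>C = J P\<^sup>H\<close> and \<open>B = C S\<inverse>\<close>.

The coupled dispersionless equations say exactly that \<open>q\<^sub>0\<close> and \<open>Q = Q\<^sub>-\<^sub>1\<close> satisfy the zero
curvature relations \<open>\<partial>\<^sub>t q\<^sub>0 = [q\<^sub>1, Q]\<close> and \<open>\<partial>\<^sub>x Q = [Q, q\<^sub>0]\<close>. These relations are the
compatibility conditions of the overdetermined linear systems for \<open>P\<close> and for the wave function \<open>w\<close>,
and they make the two prescribed derivatives of \<open>S\<close> a closed form. Existence is therefore a
Frobenius theorem on the box (\<open>frobenius_linear\<close>): solve in \<open>x\<close> along \<open>t = 0\<close>, then in \<open>t\<close> for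
each \<open>x\<close>, and show with Gronwall's inequality that the \<open>x\<close>-equation persists. Of \<open>v\<close>
only the \<open>t\<close>-derivative is available, so the theorem is formulated for coefficients with just this
regularity: the \<open>x\<close>-coefficient is differentiable in \<open>t\<close> and the \<open>t\<close>-coefficient is
differentiable in \<open>x\<close>.

The identities \<open>A S - S A\<^sup>H = \<i> P J P\<^sup>H\<close> and \<open>S = S\<^sup>H\<close> propagate from the origin, because the
linear systems make all partial derivatives of their defects vanish. The first identity turns
multiplication of \<open>S\<inverse>\<close> by \<open>A\<^sup>H\<close> from the left into multiplication by \<open>A\<close> from the right, up to
the term \<open>\<i> S\<inverse> P B\<close>; this gives \<open>B\<close> the closed equations
  \<open>\<partial>\<^sub>x B = - q\<^sub>1 B A - q\<^sub>0' B\<close>, \<open>\<partial>\<^sub>t B = - Q' B A\<inverse>\<close>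
with dressed coefficients \<open>q\<^sub>0' = q\<^sub>0 - [q\<^sub>1, \<i> B P]\<close> and \<open>Q' = (1 - X) Q (1 + Y)\<close>
(\<open>dressing_x_identity\<close>, \<open>dressing_t_identity\<close>). Consequently
\<open>W = 1 - \<i> B (A - \<lambda>)\<inverse> P\<close> is a gauge transformation from the original auxiliary systems to the
systems with the dressed coefficients (\<open>darboux_x_identity\<close>, \<open>darboux_t_identity\<close>).

It remains to recognise the dressed coefficients as \<open>q\<^sub>0\<close> and \<open>Q\<close> for the functions \<open>\<rho>'\<close> and
\<open>v'\<close>. For \<open>q\<^sub>0'\<close> this is the symmetry \<open>J (\<i>BP)\<^sup>H J = - \<i>BP\<close>. The matrix \<open>Q'\<close> has the same symmetry,
and trace \<open>0\<close> since \<open>1 + Y\<close> is the inverse of \<open>1 - X\<close>; its off-diagonal entry is \<open>- \<partial>\<^sub>t v'\<close>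
because \<open>\<partial>\<^sub>t (\<i>BP) = Q - Q'\<close>. Finally \<open>1 - X\<close> is \<open>W\<close> at \<open>\<lambda> = 0\<close>, so the \<open>x\<close>-equation of the
gauge transformation gives \<open>\<partial>\<^sub>x Q' = [Q', q\<^sub>0']\<close>, whose entries are the transformed coupled
dispersionless equations.

Conversely, \<open>W\<close> is invertible at the origin when \<open>\<lambda>\<close> is in neither spectrum, so a given wave
function of the transformed systems has the same value at the origin as \<open>W w\<close> for a suitable \<open>w\<close>.
The set where the two agree is open and closed by local uniqueness, hence they agree on every
connected neighbourhood of the origin.\<close>

section \<open>Linear ordinary differential equations on an open interval\<close>

text \<open>Instead of the norm of \<open>E\<close>, which need not be differentiable, its square is
  estimated; \<open>2 \<bar>E\<bar> \<delta> \<le> \<bar>E\<bar>\<^sup>2 + \<delta>\<^sup>2\<close> accounts for the summand \<open>1\<close> in the rate.\<close>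

lemma gronwall_linear_forward:
  fixes E :: "real \<Rightarrow> 'a::real_inner"
  assumes ab: "a \<le> b" and C: "0 \<le> C"
    and E: "\<And>t. a \<le> t \<Longrightarrow> t \<le> b \<Longrightarrow> (E has_vector_derivative E' t) (at t)"
    and bound: "\<And>t. a \<le> t \<Longrightarrow> t \<le> b \<Longrightarrow> norm (E' t) \<le> C * norm (E t) + \<delta>"
  shows "(norm (E b))\<^sup>2 \<le> ((norm (E a))\<^sup>2 + \<delta>\<^sup>2) * exp ((2 * C + 1) * (b - a))"
proof -
  \<comment> \<open>the squared norm plus \<open>\<delta>\<^sup>2\<close>, divided by its expected exponential growth\<close>
  define \<phi> where "\<phi> t = exp (- ((2 * C + 1) * (t - a))) * (E t \<bullet> E t + \<delta>\<^sup>2)" for t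
  have "\<phi> b \<le> \<phi> a"
  proof (rule DERIV_nonpos_imp_nonincreasing [OF ab])
    fix t assume t: "a \<le> t" "t \<le> b"
    have inner: "((\<lambda>t. E t \<bullet> E t) has_real_derivative 2 * (E t \<bullet> E' t)) (at t)"
      using bounded_bilinear.has_vector_derivative [OF bounded_bilinear_inner E [OF t] E [OF t]]
      by (simp add: has_real_derivative_iff_has_vector_derivative inner_commute)
    have "(\<phi> has_real_derivative exp (- ((2 * C + 1) * (t - a))) *
        (2 * (E t \<bullet> E' t) - (2 * C + 1) * (E t \<bullet> E t + \<delta>\<^sup>2))) (at t)"
      unfolding \<phi>_def
      by (rule derivative_eq_intros inner refl | simp)+ (simp add: algebra_simps)
    moreover have "2 * (E t \<bullet> E' t) - (2 * C + 1) * (E t \<bullet> E t + \<delta>\<^sup>2) \<le> 0"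
    proof -
      have "E t \<bullet> E' t \<le> norm (E t) * norm (E' t)"
        by (rule norm_cauchy_schwarz)
      also have "\<dots> \<le> norm (E t) * (C * norm (E t) + \<delta>)"
        by (rule mult_left_mono [OF bound [OF t]]) simp
      finally have 1: "2 * (E t \<bullet> E' t) \<le> 2 * C * (norm (E t))\<^sup>2 + 2 * (norm (E t) * \<delta>)"
        by (simp add: algebra_simps power2_eq_square)
      have 2: "2 * (norm (E t) * \<delta>) \<le> (norm (E t))\<^sup>2 + \<delta>\<^sup>2"
        using sum_squares_bound [of "norm (E t)" \<delta>] by (simp add: algebra_simps)
      have "0 \<le> C * \<delta>\<^sup>2" using C by simp
      with 1 2 show ?thesis by (simp add: power2_norm_eq_inner algebra_simps)
    qed
    ultimately show "\<exists>y. (\<phi> has_real_derivative y) (at t) \<and> y \<le> 0"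
      by (meson exp_ge_zero mult_nonneg_nonpos)
  qed
  then have "E b \<bullet> E b + \<delta>\<^sup>2 \<le> (E a \<bullet> E a + \<delta>\<^sup>2) * exp ((2 * C + 1) * (b - a))"
    by (simp add: \<phi>_def exp_minus divide_simps mult.commute)
  then show ?thesis
    by (smt (verit) power2_norm_eq_inner zero_le_power2)
qed

lemma has_vector_derivative_reflect:
  assumes "(f has_vector_derivative f') (at (- t))"
  shows "((\<lambda>s. f (- s)) has_vector_derivative - f') (at t)"
  using vector_diff_chain_at [OF has_vector_derivative_minus [OF has_vector_derivative_id],
      where x = t and g = f and g' = f'] assms
  by (simp add: o_def)

lemma gronwall_linear:
  fixes E :: "real \<Rightarrow> 'a::real_inner"
  assumes C: "0 \<le> C"
    and E: "\<And>t. t \<in> closed_segment a b \<Longrightarrow> (E has_vector_derivative E' t) (at t)"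
    and bound: "\<And>t. t \<in> closed_segment a b \<Longrightarrow> norm (E' t) \<le> C * norm (E t) + \<delta>"
  shows "(norm (E b))\<^sup>2 \<le> ((norm (E a))\<^sup>2 + \<delta>\<^sup>2) * exp ((2 * C + 1) * \<bar>b - a\<bar>)"
proof (cases "a \<le> b")
  case True
  then show ?thesis
    using gronwall_linear_forward [OF True C, of E E' \<delta>] E bound
    by (simp add: closed_segment_eq_real_ivl)
next
  case False
  then show ?thesis
    using gronwall_linear_forward [of "- a" "- b" C "\<lambda>s. E (- s)" "\<lambda>s. - E' (- s)" \<delta>] E bound C
    by (simp add: closed_segment_eq_real_ivl has_vector_derivative_reflect)
qed

lemma closed_segment_subset_interval:
  fixes J :: "real set"
  assumes "is_interval J" "a \<in> J" "b \<in> J"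
  shows "closed_segment a b \<subseteq> J"
  using assms by (simp add: closed_segment_subset is_interval_convex)

lemma linear_ode_unique:
  fixes M :: "real \<Rightarrow> 'a::euclidean_space \<Rightarrow>\<^sub>L 'a"
  assumes J: "is_interval J" "a \<in> J" "b \<in> J"
    and M: "continuous_on J M"
    and y: "\<And>t. t \<in> J \<Longrightarrow> (y has_vector_derivative M t (y t)) (at t)"
    and z: "\<And>t. t \<in> J \<Longrightarrow> (z has_vector_derivative M t (z t)) (at t)"
    and init: "y a = z a"
  shows "y b = z b"
proof -
  have sub: "closed_segment a b \<subseteq> J"
    by (rule closed_segment_subset_interval [OF J])
  have "bounded (M ` closed_segment a b)"
    by (intro compact_imp_bounded compact_continuous_image continuous_on_subset [OF M sub]) simp
  then obtain C where C: "\<And>t. t \<in> closed_segment a b \<Longrightarrow> norm (M t) \<le> C"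
    unfolding bounded_iff by blast
  have "0 \<le> C"
    using order_trans [OF norm_ge_zero C [of a]] by simp
  have "(norm (y b - z b))\<^sup>2 \<le> ((norm (y a - z a))\<^sup>2 + 0\<^sup>2) * exp ((2 * C + 1) * \<bar>b - a\<bar>)"
  proof (rule gronwall_linear [OF \<open>0 \<le> C\<close>])
    fix t assume t: "t \<in> closed_segment a b"
    then have "t \<in> J" using sub by blast
    then show "((\<lambda>t. y t - z t) has_vector_derivative M t (y t - z t)) (at t)"
      using has_vector_derivative_diff [OF y z] by (simp add: blinfun.diff_right)
    show "norm (M t (y t - z t)) \<le> C * norm (y t - z t) + 0"
      using order_trans [OF norm_blinfun mult_right_mono [OF C [OF t]]] by simp
  qed
  then show ?thesis by (simp add: init)
qed

text \<open>The signed integral from \<open>a\<close> is written as a difference of two integrals,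
  one of which always has a degenerate or empty domain.\<close>

lemma antiderivative_open_interval:
  fixes f :: "real \<Rightarrow> 'a::banach"
  assumes J: "open J" "is_interval J" "a \<in> J" and f: "continuous_on J f"
  obtains F where "F a = 0" "\<And>t. t \<in> J \<Longrightarrow> (F has_vector_derivative f t) (at t)"
proof -
  let ?F = "\<lambda>t. integral {a..t} f - integral {t..a} f"
  have "(?F has_vector_derivative f t) (at t)" if t: "t \<in> J" for t
  proof -
    obtain d where d: "d > 0" "cball (min a t) d \<subseteq> J"
      using open_contains_cball [of J] J t by (metis min_def)
    obtain e where e: "e > 0" "cball (max a t) e \<subseteq> J"
      using open_contains_cball [of J] J t by (metis max_def)
    define u w where "u = min a t - d" and "w = max a t + e"
    have uw: "u \<in> J" "w \<in> J" "u < a" "a < w" "u < t" "t < w"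
      using d e by (auto simp: u_def w_def dist_real_def subset_iff)
    then have sub: "{u..w} \<subseteq> J"
      using closed_segment_subset_interval [OF J(2), of u w] by (simp add: closed_segment_eq_real_ivl)
    have cont: "continuous_on {u..w} f" by (rule continuous_on_subset [OF f sub])
    have split: "integral {u..s} f - integral {u..a} f = ?F s" if "s \<in> {u<..<w}" for s
    proof (cases "a \<le> s")
      case True
      have "integral {u..a} f + integral {a..s} f = integral {u..s} f"
        using that uw True
        by (intro Henstock_Kurzweil_Integration.integral_combine
             integrable_continuous_interval continuous_on_subset [OF cont]) auto
      moreover have "integral {s..a} f = 0" using True by (cases "s = a") auto
      ultimately show ?thesis by (simp add: algebra_simps)
    next
      case False
      have "integral {u..s} f + integral {s..a} f = integral {u..a} f"
        using that uw False
        by (intro Henstock_Kurzweil_Integration.integral_combine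
             integrable_continuous_interval continuous_on_subset [OF cont]) auto
      moreover have "integral {a..s} f = 0" using False by auto
      ultimately show ?thesis by (simp add: algebra_simps)
    qed
    have "((\<lambda>s. integral {u..s} f) has_vector_derivative f t) (at t within {u..w})"
      using integral_has_vector_derivative [OF cont] uw by auto
    then have "((\<lambda>s. integral {u..s} f) has_vector_derivative f t) (at t)"
      using uw by (simp add: at_within_Icc_at)
    then have "((\<lambda>s. integral {u..s} f - integral {u..a} f) has_vector_derivative f t) (at t)"
      by (simp only: has_vector_derivative_diff_const)
    then show "(?F has_vector_derivative f t) (at t)"
      by (rule has_vector_derivative_transform_within_open [where S = "{u<..<w}"]) (use uw split in auto)
  qed
  then show thesis by (intro that [of ?F]) auto
qed

lemma power_growth_of_antiderivative:
  fixes F :: "real \<Rightarrow> 'a::real_normed_vector"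
  assumes F: "\<And>t. t \<in> closed_segment a b \<Longrightarrow> (F has_vector_derivative f t) (at t)"
    and f: "\<And>t. t \<in> closed_segment a b \<Longrightarrow> norm (f t) \<le> K * \<bar>t - a\<bar> ^ n"
  shows "norm (F b - F a) \<le> K * \<bar>b - a\<bar> ^ Suc n / Suc n"
proof -
  have forward: "norm (F b - F a) \<le> K * (b - a) ^ Suc n / Suc n"
    if "a < b" and F: "\<And>t. t \<in> {a..b} \<Longrightarrow> (F has_vector_derivative f t) (at t)"
      and f: "\<And>t. t \<in> {a..b} \<Longrightarrow> norm (f t) \<le> K * (t - a) ^ n"
    for a b and F f :: "real \<Rightarrow> 'a"
  proof -
    have "norm (F b - F a) \<le> K * (b - a) ^ Suc n / Suc n - K * (a - a) ^ Suc n / Suc n"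
    proof (rule differentiable_bound_general [OF \<open>a < b\<close>])
      show "continuous_on {a..b} F"
        by (intro continuous_at_imp_continuous_on ballI has_vector_derivative_continuous [OF F]) auto
      show "continuous_on {a..b} (\<lambda>t. K * (t - a) ^ Suc n / Suc n)"
        by (intro continuous_intros) auto
      fix t assume t: "a < t" "t < b"
      then show "(F has_vector_derivative f t) (at t)" by (simp add: F)
      have "((\<lambda>t. K * (t - a) ^ Suc n / Suc n) has_real_derivative K * (t - a) ^ n) (at t)"
        by (rule derivative_eq_intros refl | simp del: of_nat_Suc)+
      then show "((\<lambda>t. K * (t - a) ^ Suc n / Suc n) has_vector_derivative K * (t - a) ^ n) (at t)"
        by (simp add: has_real_derivative_iff_has_vector_derivative)
      show "norm (f t) \<le> K * (t - a) ^ n" using f t by simp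
    qed
    then show ?thesis by simp
  qed
  consider "a < b" | "a = b" | "b < a" by linarith
  then show ?thesis
  proof cases
    case 1
    then show ?thesis
      using forward [of a b F f] F f by (simp add: closed_segment_eq_real_ivl)
  next
    case 2
    then show ?thesis by simp
  next
    case 3
    have "norm (F (- (- b)) - F (- (- a))) \<le> K * (- b - (- a)) ^ Suc n / Suc n"
    proof (rule forward [of "- a" "- b" "\<lambda>s. F (- s)" "\<lambda>s. - f (- s)"])
      fix t assume "t \<in> {- a..- b}"
      then have t: "- t \<in> closed_segment a b" using 3 by (simp add: closed_segment_eq_real_ivl)
      from F [OF t] show "((\<lambda>s. F (- s)) has_vector_derivative - f (- t)) (at t)"
        by (rule has_vector_derivative_reflect)
      have "\<bar>- t - a\<bar> = t - - a" using \<open>t \<in> {- a..- b}\<close> by auto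
      with f [OF t] show "norm (- f (- t)) \<le> K * (t - - a) ^ n" by simp
    qed (use 3 in simp)
    then show ?thesis using 3 by simp
  qed
qed

text \<open>Picard iteration. On a compact interval the \<open>n\<close>th increment is of order \<open>1 / n!\<close>, hence
  the series converges locally uniformly on the whole open interval and no continuation is needed.\<close>

lemma linear_ode_exists:
  fixes M :: "real \<Rightarrow> 'a::euclidean_space \<Rightarrow>\<^sub>L 'a"
  assumes J: "open J" "is_interval J" "a \<in> J" and M: "continuous_on J M"
  obtains y where "y a = c" "\<And>t. t \<in> J \<Longrightarrow> (y has_vector_derivative M t (y t)) (at t)"
proof -
  have step: "\<exists>G. G a = 0 \<and> (\<forall>t\<in>J. (G has_vector_derivative M t (F t)) (at t))"
    if "continuous_on J F" for F
    using antiderivative_open_interval [OF J, of "\<lambda>t. M t (F t)"] that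
    by (metis blinfun.continuous_on M)
  define next_iterate where "next_iterate F =
      (SOME G. G a = 0 \<and> (\<forall>t\<in>J. (G has_vector_derivative M t (F t)) (at t)))" for F
  define Y where "Y n = (next_iterate ^^ n) (\<lambda>_. c)" for n
  have next_iterate: "next_iterate F a = 0"
    "\<And>t. t \<in> J \<Longrightarrow> (next_iterate F has_vector_derivative M t (F t)) (at t)"
    if "continuous_on J F" for F
    using someI_ex [OF step [OF that]] by (auto simp: next_iterate_def)
  have contY: "continuous_on J (Y n)" for n
  proof (induction n)
    case 0
    then show ?case by (simp add: Y_def)
  next
    case (Suc n)
    show ?case
      using next_iterate(2) [OF Suc]
      by (auto simp: Y_def intro!: continuous_at_imp_continuous_on
          intro: has_vector_derivative_continuous)
  qed
  have Y0: "Y 0 t = c" for t by (simp add: Y_def)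
  have Ya: "Y (Suc n) a = 0" for n
    using next_iterate(1) [OF contY [of n]] by (simp add: Y_def)
  have Y': "(Y (Suc n) has_vector_derivative M t (Y n t)) (at t)" if "t \<in> J" for n t
    using next_iterate(2) [OF contY [of n] that] by (simp add: Y_def)
  define y where "y t = (\<Sum>n. Y n t)" for t
  show thesis
  proof
    have "(\<lambda>n. Y (Suc n) a) sums 0" by (simp add: Ya)
    then have "(\<lambda>n. Y n a) sums (0 + Y 0 a)" by (rule sums_Suc)
    then show "y a = c" by (simp add: y_def sums_iff Y0)
  next
    fix t assume t: "t \<in> J"
    obtain d where d: "d > 0" "cball (min a t) d \<subseteq> J"
      using open_contains_cball [of J] J t by (metis min_def)
    obtain e where e: "e > 0" "cball (max a t) e \<subseteq> J"
      using open_contains_cball [of J] J t by (metis max_def)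
    define u w where "u = min a t - d" and "w = max a t + e"
    have uw: "u \<in> J" "w \<in> J" "u < a" "a < w" "u < t" "t < w"
      using d e by (auto simp: u_def w_def dist_real_def subset_iff)
    then have sub: "{u..w} \<subseteq> J"
      using closed_segment_subset_interval [OF J(2), of u w] by (simp add: closed_segment_eq_real_ivl)
    have "bounded (M ` {u..w})"
      by (intro compact_imp_bounded compact_continuous_image continuous_on_subset [OF M sub]) simp
    then obtain C where C: "\<And>t. t \<in> {u..w} \<Longrightarrow> norm (M t) \<le> C"
      unfolding bounded_iff by blast
    have C0: "0 \<le> C"
      using order_trans [OF norm_ge_zero C [of a]] uw by simp
    have bound: "norm (Y n s) \<le> norm c * C ^ n / fact n * \<bar>s - a\<bar> ^ n" if "s \<in> {u..w}" for n s
      using that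
    proof (induction n arbitrary: s)
      case 0
      then show ?case by (simp add: Y0)
    next
      case (Suc n)
      have seg: "closed_segment a s \<subseteq> {u..w}"
        using Suc.prems uw by (auto simp: closed_segment_eq_real_ivl split: if_splits)
      have "norm (Y (Suc n) s - Y (Suc n) a)
          \<le> C * (norm c * C ^ n / fact n) * \<bar>s - a\<bar> ^ Suc n / Suc n"
      proof (rule power_growth_of_antiderivative)
        fix r assume r: "r \<in> closed_segment a s"
        then show "(Y (Suc n) has_vector_derivative M r (Y n r)) (at r)"
          using Y' seg sub by blast
        have "norm (M r (Y n r)) \<le> C * norm (Y n r)"
          using order_trans [OF norm_blinfun mult_right_mono [OF C]] r seg by auto
        also have "\<dots> \<le> C * (norm c * C ^ n / fact n * \<bar>r - a\<bar> ^ n)"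
          using Suc.IH [of r] r seg C0 by (intro mult_left_mono) auto
        finally show "norm (M r (Y n r)) \<le> C * (norm c * C ^ n / fact n) * \<bar>r - a\<bar> ^ n"
          by (simp add: mult_ac)
      qed
      then show ?case by (simp add: Ya field_simps)
    qed
    define R where "R = w - u"
    \<comment> \<open>the terms of an exponential series, a summable majorant on \<open>{u..w}\<close>\<close>
    define m where "m n = norm c * (C * R) ^ n / fact n" for n
    have bound_m: "norm (Y n s) \<le> m n" if "s \<in> {u..w}" for n s
    proof -
      have "\<bar>s - a\<bar> \<le> R" using that uw by (auto simp: R_def)
      then have "norm c * C ^ n / fact n * \<bar>s - a\<bar> ^ n \<le> norm c * C ^ n / fact n * R ^ n"
        using C0 by (intro mult_left_mono power_mono) auto
      from order_trans [OF bound [OF that] this] show ?thesis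
        by (simp add: m_def power_mult_distrib mult_ac)
    qed
    have m: "summable m"
    proof -
      have "summable (\<lambda>n. norm c * (inverse (fact n) * (C * R) ^ n))"
        by (intro summable_mult summable_exp)
      then show ?thesis unfolding m_def by (simp add: field_simps)
    qed
    have summY: "summable (\<lambda>n. Y n s)" if "s \<in> {u..w}" for s
      using bound_m [OF that] m by (rule summable_comparison_test' [rotated])
    have unif: "uniform_limit {u..w} (\<lambda>n s. \<Sum>i<n. Y i s) y sequentially"
      unfolding y_def by (rule Weierstrass_m_test [OF bound_m m])
    have "\<exists>g. \<forall>s\<in>{u..w}. (\<lambda>n. Y (Suc n) s) sums g s \<and>
        (g has_derivative (\<lambda>h. h *\<^sub>R M s (y s))) (at s within {u..w})"
    proof (rule has_derivative_series)
      show "convex {u..w}" by simp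
      show "(Y (Suc n) has_derivative (\<lambda>h. h *\<^sub>R M s (Y n s))) (at s within {u..w})"
        if "s \<in> {u..w}" for n s
        using has_vector_derivative_at_within [OF Y'] that sub
        unfolding has_vector_derivative_def by blast
      show "\<forall>\<^sub>F n in sequentially. \<forall>s\<in>{u..w}. \<forall>h.
          norm ((\<Sum>i<n. h *\<^sub>R M s (Y i s)) - h *\<^sub>R M s (y s)) \<le> \<epsilon> * norm h" if "0 < \<epsilon>" for \<epsilon>
      proof -
        have "\<forall>\<^sub>F n in sequentially. \<forall>s\<in>{u..w}. dist (\<Sum>i<n. Y i s) (y s) < \<epsilon> / (C + 1)"
          using unif that C0 by (intro uniform_limitD) auto
        then show ?thesis
        proof eventually_elim
          case (elim n)
          show ?case
          proof (intro ballI allI)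
            fix s h assume s: "s \<in> {u..w}"
            have "norm ((\<Sum>i<n. h *\<^sub>R M s (Y i s)) - h *\<^sub>R M s (y s))
                = norm h * norm (M s ((\<Sum>i<n. Y i s) - y s))"
              by (simp add: blinfun.diff_right blinfun.sum_right scaleR_sum_right [symmetric]
                  flip: scaleR_diff_right)
            also have "\<dots> \<le> norm h * (C * (\<epsilon> / (C + 1)))"
            proof (rule mult_left_mono)
              have "norm (M s ((\<Sum>i<n. Y i s) - y s)) \<le> norm (M s) * norm ((\<Sum>i<n. Y i s) - y s)"
                by (rule norm_blinfun)
              also have "\<dots> \<le> C * (\<epsilon> / (C + 1))"
                using elim s C [OF s] C0 by (intro mult_mono) (auto simp: dist_norm less_imp_le)
              finally show "norm (M s ((\<Sum>i<n. Y i s) - y s)) \<le> C * (\<epsilon> / (C + 1))" .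
            qed simp
            also have "\<dots> \<le> norm h * \<epsilon>"
              using C0 that by (intro mult_left_mono) (auto simp: field_simps)
            finally show "norm ((\<Sum>i<n. h *\<^sub>R M s (Y i s)) - h *\<^sub>R M s (y s)) \<le> \<epsilon> * norm h"
              by (simp add: mult.commute)
          qed
        qed
      qed
      show "a \<in> {u..w}" using uw by simp
      show "(\<lambda>n. Y (Suc n) a) sums 0" by (simp add: Ya)
    qed
    then obtain g where g: "\<And>s. s \<in> {u..w} \<Longrightarrow> (\<lambda>n. Y (Suc n) s) sums g s"
      "\<And>s. s \<in> {u..w} \<Longrightarrow> (g has_derivative (\<lambda>h. h *\<^sub>R M s (y s))) (at s within {u..w})"
      by blast
    have yg: "g s + c = y s" if "s \<in> {u..w}" for s
      using sums_Suc [OF g(1) [OF that]] by (simp add: y_def sums_iff Y0)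
    have "(g has_vector_derivative M t (y t)) (at t)"
      using g(2) [of t] uw by (simp add: has_vector_derivative_def at_within_Icc_at)
    then have "((\<lambda>s. g s + c) has_vector_derivative M t (y t)) (at t)"
      by (simp only: has_vector_derivative_add_const)
    then show "(y has_vector_derivative M t (y t)) (at t)"
      by (rule has_vector_derivative_transform_within_open [where S = "{u<..<w}"])
         (use uw yg in auto)
  qed
qed

section \<open>Compatible linear systems in two variables\<close>

text \<open>A form that is homogeneous in \<open>\<delta>\<close>: the factor of \<open>\<delta>\<close> in the conclusion
  depends on the bounds of the equation only, so that an \<open>o(h)\<close> defect yields an \<open>o(h)\<close> solution.\<close>

lemma gronwall_linear_scaled:
  fixes E :: "real \<Rightarrow> 'a::real_inner"
  assumes C: "0 \<le> C" and \<delta>: "0 \<le> \<delta>" and R: "\<bar>b - a\<bar> \<le> R"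
    and E: "\<And>t. t \<in> closed_segment a b \<Longrightarrow> (E has_vector_derivative E' t) (at t)"
    and init: "norm (E a) \<le> \<delta>"
    and bound: "\<And>t. t \<in> closed_segment a b \<Longrightarrow> norm (E' t) \<le> C * norm (E t) + B * \<delta>"
  shows "norm (E b) \<le> \<delta> * sqrt ((1 + B\<^sup>2) * exp ((2 * C + 1) * R))"
proof -
  have "(norm (E b))\<^sup>2 \<le> ((norm (E a))\<^sup>2 + (B * \<delta>)\<^sup>2) * exp ((2 * C + 1) * \<bar>b - a\<bar>)"
    by (rule gronwall_linear [OF C E bound])
  also have "\<dots> \<le> (\<delta>\<^sup>2 + (B * \<delta>)\<^sup>2) * exp ((2 * C + 1) * R)"
    using C R init by (intro mult_mono add_right_mono power_mono) (auto intro!: mult_left_mono)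
  also have "\<dots> = (\<delta> * sqrt ((1 + B\<^sup>2) * exp ((2 * C + 1) * R)))\<^sup>2"
    by (simp add: power_mult_distrib algebra_simps)
  finally show ?thesis
    by (rule power2_le_imp_le) (use \<delta> in simp)
qed

text \<open>Uniform continuity on a compact neighbourhood of \<open>{x} \<times> K\<close>.\<close>

lemma continuous_on_product_tube:
  fixes f :: "real \<Rightarrow> real \<Rightarrow> 'a::metric_space"
  assumes I: "open I" "x \<in> I" and K: "compact K" "K \<subseteq> J"
    and f: "continuous_on (I \<times> J) (\<lambda>(x, t). f x t)" and \<eta>: "0 < \<eta>"
  obtains d where "0 < d" "\<And>x' s. dist x' x < d \<Longrightarrow> s \<in> K \<Longrightarrow> dist (f x' s) (f x s) < \<eta>"
proof -
  obtain r where r: "r > 0" "cball x r \<subseteq> I"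
    using I open_contains_cball_eq [OF I(1)] by blast
  have "uniformly_continuous_on (cball x r \<times> K) (\<lambda>(x, t). f x t)"
    using r K by (intro compact_uniformly_continuous continuous_on_subset [OF f] compact_Times) auto
  then obtain d where d: "d > 0" "\<And>p q. p \<in> cball x r \<times> K \<Longrightarrow> q \<in> cball x r \<times> K \<Longrightarrow> dist q p < d \<Longrightarrow>
      dist ((\<lambda>(x, t). f x t) q) ((\<lambda>(x, t). f x t) p) < \<eta>"
    using \<eta> unfolding uniformly_continuous_on_def by metis
  show thesis
  proof
    show "0 < min d r" using d r by simp
    fix x' s assume "dist x' x < min d r" "s \<in> K"
    then show "dist (f x' s) (f x s) < \<eta>"
      using d(2) [of "(x, s)" "(x', s)"] r by (simp add: dist_commute dist_Pair_Pair)
  qed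
qed

lemma continuous_on_product_sections:
  assumes f: "continuous_on (I \<times> J) (\<lambda>(x, t). f x t)"
  shows "t \<in> J \<Longrightarrow> continuous_on I (\<lambda>x. f x t)" and "x \<in> I \<Longrightarrow> continuous_on J (\<lambda>t. f x t)"
proof -
  have "continuous_on I (\<lambda>x. case (x, t) of (x, t) \<Rightarrow> f x t)" if "t \<in> J" for t
    by (rule continuous_on_compose2 [OF f]) (use that in \<open>auto intro!: continuous_intros\<close>)
  then show "t \<in> J \<Longrightarrow> continuous_on I (\<lambda>x. f x t)" by simp
  have "continuous_on J (\<lambda>t. case (x, t) of (x, t) \<Rightarrow> f x t)" if "x \<in> I" for x
    by (rule continuous_on_compose2 [OF f]) (use that in \<open>auto intro!: continuous_intros\<close>)
  then show "x \<in> I \<Longrightarrow> continuous_on J (\<lambda>t. f x t)" by simp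
qed

text \<open>If \<open>y\<^sub>x = L y\<close> and \<open>y\<^sub>t = M y\<close>, equality of the mixed derivatives means
  \<open>M\<^sub>x = L\<^sub>t + L M - M L\<close>, and this condition suffices. The solution \<open>y\<close> is built from ordinary
  differential equations, first along \<open>t = t0\<close> and then along the lines of constant \<open>x\<close>. For
  \<open>K = L y\<close> the compatibility condition gives \<open>K\<^sub>t = M\<^sub>x y + M K\<close>, which is the equation of \<open>y\<^sub>t = M y\<close>
  linearised in \<open>x\<close>. So \<open>y(x + h, t) - y(x, t) - h K(x, t)\<close> satisfies a linear equation with forcing
  and initial value of order \<open>o(h)\<close>, and Gronwall's inequality identifies \<open>K\<close> as the
  \<open>x\<close>-derivative. Joint continuity of \<open>y\<close> is the same estimate without the linear term; it allows
  further systems with coefficients built from \<open>y\<close>.\<close>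

lemma frobenius_linear:
  fixes L M M' :: "real \<Rightarrow> real \<Rightarrow> 'a::euclidean_space \<Rightarrow>\<^sub>L 'a"
  assumes I: "open I" "is_interval I" "x0 \<in> I"
    and J: "open J" "is_interval J" "t0 \<in> J"
    and L: "continuous_on (I \<times> J) (\<lambda>(x, t). L x t)"
    and M: "continuous_on (I \<times> J) (\<lambda>(x, t). M x t)"
    and M': "continuous_on (I \<times> J) (\<lambda>(x, t). M' x t)"
    and Mx: "\<And>x t. x \<in> I \<Longrightarrow> t \<in> J \<Longrightarrow> ((\<lambda>s. M s t) has_vector_derivative M' x t) (at x)"
    and Lt: "\<And>x t. x \<in> I \<Longrightarrow> t \<in> J \<Longrightarrow> ((\<lambda>s. L x s) has_vector_derivative
               (M' x t - (L x t o\<^sub>L M x t) + (M x t o\<^sub>L L x t))) (at t)"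
  obtains y where "y x0 t0 = y0"
    and "continuous_on (I \<times> J) (\<lambda>(x, t). y x t)"
    and "\<And>x t. x \<in> I \<Longrightarrow> t \<in> J \<Longrightarrow> ((\<lambda>s. y s t) has_vector_derivative L x t (y x t)) (at x)"
    and "\<And>x t. x \<in> I \<Longrightarrow> t \<in> J \<Longrightarrow> ((\<lambda>s. y x s) has_vector_derivative M x t (y x t)) (at t)"
proof -
  have nbhd_I: "\<exists>r>0. cball x r \<subseteq> I" if "x \<in> I" for x
    using open_contains_cball_eq [OF I(1)] that by simp
  have nbhd_J: "\<exists>r>0. cball t r \<subseteq> J" if "t \<in> J" for t
    using open_contains_cball_eq [OF J(1)] that by simp
  note Lrow = continuous_on_product_sections(1) [OF L]
  note Mcol = continuous_on_product_sections(2) [OF M]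
  obtain c where c: "c x0 = y0"
    and c': "\<And>x. x \<in> I \<Longrightarrow> (c has_vector_derivative L x t0 (c x)) (at x)"
    using linear_ode_exists [OF I Lrow [OF J(3)], of y0] by metis
  have "\<exists>z. z t0 = c x \<and> (\<forall>t\<in>J. (z has_vector_derivative M x t (z t)) (at t))" if "x \<in> I" for x
    using linear_ode_exists [OF J Mcol [OF that], of "c x"] by metis
  then obtain y where y0: "\<And>x. x \<in> I \<Longrightarrow> y x t0 = c x"
    and yt: "\<And>x t. x \<in> I \<Longrightarrow> t \<in> J \<Longrightarrow> ((\<lambda>s. y x s) has_vector_derivative M x t (y x t)) (at t)"
    by metis
  have ycol: "continuous_on J (\<lambda>t. y x t)" if "x \<in> I" for x
    using yt [OF that]
    by (auto intro!: continuous_at_imp_continuous_on intro: has_vector_derivative_continuous)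
  have segment: "closed_segment t0 t \<subseteq> J" if "t \<in> J" for t
    by (rule closed_segment_subset_interval [OF J(2,3) that])
  have bounded_coeff: "\<exists>r>0. cball x r \<subseteq> I \<and> (\<exists>C\<ge>0. \<forall>x'\<in>cball x r. \<forall>s\<in>K. norm (M x' s) \<le> C)"
    if x: "x \<in> I" and K: "compact K" "K \<subseteq> J" for x K
  proof -
    obtain r where r: "r > 0" "cball x r \<subseteq> I"
      using nbhd_I [OF x] by blast
    have "compact (cball x r \<times> K)" using K by (intro compact_Times compact_cball)
    moreover have "continuous_on (cball x r \<times> K) (\<lambda>(x, t). M x t)"
      by (rule continuous_on_subset [OF M]) (use r K in blast)
    ultimately have "bounded ((\<lambda>(x, t). M x t) ` (cball x r \<times> K))"
      by (intro compact_imp_bounded compact_continuous_image)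
    then obtain C where C: "\<And>p. p \<in> cball x r \<times> K \<Longrightarrow> norm (case p of (x, t) \<Rightarrow> M x t) \<le> C"
      unfolding bounded_iff by blast
    have "norm (M x' s) \<le> max C 0" if "x' \<in> cball x r" "s \<in> K" for x' s
      using C [of "(x', s)"] that by (simp add: le_max_iff_disj)
    then show ?thesis
      using r by (intro exI [of _ r] conjI exI [of _ "max C 0"]) auto
  qed
  have yx: "((\<lambda>s. y s t) has_vector_derivative L x t (y x t)) (at x)" if x: "x \<in> I" and t: "t \<in> J" for x t
  proof -
    define T where "T = closed_segment t0 t"
    have T: "compact T" "T \<subseteq> J" "t0 \<in> T" "t \<in> T"
      using segment [OF t] by (auto simp: T_def)
    obtain r C where r: "r > 0" "cball x r \<subseteq> I" and C: "C \<ge> 0"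
      "\<And>x' s. x' \<in> cball x r \<Longrightarrow> s \<in> T \<Longrightarrow> norm (M x' s) \<le> C"
      using bounded_coeff [OF x T(1,2)] by auto
    define K where "K s = L x s (y x s)" for s
    have Kt: "(K has_vector_derivative blinfun_apply (M' x s) (y x s) + blinfun_apply (M x s) (K s)) (at s)" if "s \<in> J" for s
      using bounded_bilinear.has_vector_derivative
          [OF bounded_bilinear_blinfun_apply Lt [OF x that] yt [OF x that]]
      by (simp add: K_def [abs_def] blinfun.add_left blinfun.diff_left)
    have "continuous_on T K"
      using Kt T by (auto intro!: continuous_at_imp_continuous_on intro: has_vector_derivative_continuous)
    then have "bounded (K ` T)" "bounded (y x ` T)"
      using T(1) continuous_on_subset [OF ycol [OF x] T(2)]
      by (auto intro!: compact_imp_bounded compact_continuous_image)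
    then obtain B1 B2 where "\<And>s. s \<in> T \<Longrightarrow> norm (K s) \<le> B1" "\<And>s. s \<in> T \<Longrightarrow> norm (y x s) \<le> B2"
      unfolding bounded_iff by auto
    then obtain B where B: "\<And>s. s \<in> T \<Longrightarrow> norm (K s) \<le> B" "\<And>s. s \<in> T \<Longrightarrow> norm (y x s) \<le> B"
      by (metis max.coboundedI1 max.coboundedI2)
    have B0: "0 \<le> B" using order_trans [OF norm_ge_zero B(1) [OF T(3)]] .
    define Q where "Q = sqrt ((1 + (2 * B)\<^sup>2) * exp ((2 * C + 1) * \<bar>t - t0\<bar>))"
    have Q: "0 < Q" by (simp add: Q_def add_pos_nonneg)
    show ?thesis
      unfolding has_vector_derivative_def has_derivative_at_alt
    proof (intro conjI allI impI)
      show "bounded_linear (\<lambda>h. h *\<^sub>R L x t (y x t))" by (rule bounded_linear_scaleR_left)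
      fix e :: real assume e: "0 < e"
      define \<eta> where "\<eta> = e / Q"
      have \<eta>: "0 < \<eta>" using e Q by (simp add: \<eta>_def)
      obtain d1 where d1: "0 < d1" "\<And>x' s. dist x' x < d1 \<Longrightarrow> s \<in> T \<Longrightarrow> dist (M x' s) (M x s) < \<eta>"
        using continuous_on_product_tube [OF I(1) x T(1,2) M \<eta>] by blast
      obtain d2 where d2: "0 < d2" "\<And>x' s. dist x' x < d2 \<Longrightarrow> s \<in> T \<Longrightarrow> dist (M' x' s) (M' x s) < \<eta>"
        using continuous_on_product_tube [OF I(1) x T(1,2) M' \<eta>] by blast
      obtain d3 where d3: "0 < d3" "\<And>x'. norm (x' - x) < d3 \<Longrightarrow>
          norm (c x' - c x - (x' - x) *\<^sub>R L x t0 (c x)) \<le> \<eta> * norm (x' - x)"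
        using c' [OF x] \<eta> unfolding has_vector_derivative_def has_derivative_at_alt by blast
      define d where "d = min (min d1 d2) (min d3 r)"
      have "norm (y x' t - y x t - (x' - x) *\<^sub>R L x t (y x t)) \<le> e * norm (x' - x)"
        if x': "norm (x' - x) < d" for x'
      proof -
        define h where "h = x' - x"
        have x'I: "x' \<in> I" "x' \<in> cball x r"
          using x' r by (auto simp: d_def dist_norm norm_minus_commute)
        \<comment> \<open>the error of the first-order expansion in \<open>x\<close> and its derivative in \<open>t\<close>\<close>
        define E where "E s = y x' s - y x s - h *\<^sub>R K s" for s
        define E' where "E' s = blinfun_apply (M x' s) (E s) + blinfun_apply (M x' s - M x s - h *\<^sub>R M' x s) (y x s)
            + h *\<^sub>R blinfun_apply (M x' s - M x s) (K s)" for s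
        have increment: "norm (M x' s - M x s - h *\<^sub>R M' x s) \<le> \<eta> * \<bar>h\<bar>" if s: "s \<in> T" for s
        proof -
          have "norm (M x' s - M x s - (x' - x) *\<^sub>R M' x s) \<le> norm (x' - x) * \<eta>"
          proof (rule vector_differentiable_bound_linearization
              [where S = "ball x d" and f = "\<lambda>z. M z s" and f' = "\<lambda>z. M' z s"])
            show "((\<lambda>z. M z s) has_vector_derivative M' z s) (at z within ball x d)"
              if "z \<in> ball x d" for z
            proof (rule has_vector_derivative_at_within [OF Mx])
              show "z \<in> I" using that r by (auto simp: d_def)
              show "s \<in> J" using s T by blast
            qed
            show "closed_segment x x' \<subseteq> ball x d"
              using x' by (intro closed_segment_subset) (auto simp: dist_norm norm_minus_commute)
            show "norm (M' z s - M' x s) \<le> \<eta>" if "z \<in> ball x d" for z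
              using d2(2) [of z s] that s by (auto simp: d_def dist_norm norm_minus_commute less_imp_le)
            show "x \<in> ball x d" using d1 d2 d3 r by (simp add: d_def)
          qed
          then show ?thesis by (simp add: h_def mult.commute)
        qed
        have "norm (E t) \<le> (\<eta> * \<bar>h\<bar>) * Q"
          unfolding Q_def
        proof (rule gronwall_linear_scaled [OF C(1), where E' = E'])
          show "0 \<le> \<eta> * \<bar>h\<bar>" using \<eta> by simp
          show "norm (E t0) \<le> \<eta> * \<bar>h\<bar>"
            using d3(2) [of x'] x' by (simp add: E_def K_def h_def y0 x x'I d_def)
          fix s assume "s \<in> closed_segment t0 t"
          then have s: "s \<in> T" "s \<in> J" using T by (auto simp: T_def)
          have "(E has_vector_derivative blinfun_apply (M x' s) (y x' s) - blinfun_apply (M x s) (y x s)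
              - h *\<^sub>R (blinfun_apply (M' x s) (y x s) + blinfun_apply (M x s) (K s))) (at s)"
            unfolding E_def
            by (intro has_vector_derivative_diff yt x x'I s
                bounded_linear.has_vector_derivative [OF bounded_linear_scaleR_right] Kt)
          moreover have "blinfun_apply (M x' s) (y x' s) - blinfun_apply (M x s) (y x s)
              - h *\<^sub>R (blinfun_apply (M' x s) (y x s) + blinfun_apply (M x s) (K s)) = E' s"
            by (simp add: E'_def E_def blinfun.bilinear_simps algebra_simps)
          ultimately show "(E has_vector_derivative E' s) (at s)" by simp
          have "norm (E' s) \<le> norm (M x' s) * norm (E s)
              + norm (M x' s - M x s - h *\<^sub>R M' x s) * norm (y x s)
              + \<bar>h\<bar> * (norm (M x' s - M x s) * norm (K s))"
            unfolding E'_def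
            by (intro norm_triangle_mono norm_blinfun) (simp add: norm_blinfun mult_left_mono)
          also have "\<dots> \<le> C * norm (E s) + (\<eta> * \<bar>h\<bar>) * B + \<bar>h\<bar> * (\<eta> * B)"
          proof (intro add_mono mult_mono mult_left_mono)
            show "norm (M x' s) \<le> C" by (rule C(2) [OF x'I(2) s(1)])
            show "norm (M x' s - M x s - h *\<^sub>R M' x s) \<le> \<eta> * \<bar>h\<bar>" by (rule increment [OF s(1)])
            show "norm (M x' s - M x s) \<le> \<eta>"
              using d1(2) [of x' s] x' s by (simp add: d_def dist_norm)
          qed (use C(1) \<eta> B s in simp_all)
          finally show "norm (E' s) \<le> C * norm (E s) + 2 * B * (\<eta> * \<bar>h\<bar>)"
            by (simp add: algebra_simps)
        qed simp
        then show ?thesis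
          using Q by (simp add: E_def K_def h_def \<eta>_def)
      qed
      moreover have "0 < d" using d1 d2 d3 r by (simp add: d_def)
      ultimately show "\<exists>d>0. \<forall>x'. norm (x' - x) < d \<longrightarrow>
          norm (y x' t - y x t - (x' - x) *\<^sub>R L x t (y x t)) \<le> e * norm (x' - x)"
        by blast
    qed
  qed
  have "isCont (\<lambda>(x, t). y x t) (x, t)" if x: "x \<in> I" and t: "t \<in> J" for x t
  proof -
    obtain a where a: "a > 0" "cball t a \<subseteq> J"
      using nbhd_J [OF t] by blast
    define u w where "u = min t0 (t - a)" and "w = max t0 (t + a)"
    have "t - a \<in> J" "t + a \<in> J" using a by (auto simp: dist_norm subset_iff)
    then have uw: "u \<in> J" "w \<in> J" "u \<le> t0" "t0 \<le> w" "u \<le> t - a" "t + a \<le> w"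
      using J a by (auto simp: u_def w_def min_def max_def)
    \<comment> \<open>a compact interval that contains \<open>t0\<close> and a neighbourhood of \<open>t\<close>\<close>
    define T where "T = {u..w}"
    have T: "compact T" "T \<subseteq> J" "t0 \<in> T"
      using closed_segment_subset_interval [OF J(2) uw(1,2)] uw
      by (auto simp: T_def closed_segment_eq_real_ivl)
    obtain r C where r: "r > 0" "cball x r \<subseteq> I" and C: "C \<ge> 0"
      "\<And>x' s. x' \<in> cball x r \<Longrightarrow> s \<in> T \<Longrightarrow> norm (M x' s) \<le> C"
      using bounded_coeff [OF x T(1,2)] by auto
    have "bounded (y x ` T)"
      using T(1) continuous_on_subset [OF ycol [OF x] T(2)]
      by (auto intro!: compact_imp_bounded compact_continuous_image)
    then obtain B where B: "\<And>s. s \<in> T \<Longrightarrow> norm (y x s) \<le> B"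
      unfolding bounded_iff by auto
    define Q where "Q = sqrt ((1 + B\<^sup>2) * exp ((2 * C + 1) * (w - u)))"
    have Q: "0 < Q" by (simp add: Q_def add_pos_nonneg)
    show ?thesis
      unfolding continuous_at_eps_delta
    proof (intro allI impI)
      fix e :: real assume e: "0 < e"
      define \<eta> where "\<eta> = e / (2 * Q)"
      have \<eta>: "0 < \<eta>" using e Q by (simp add: \<eta>_def)
      obtain d1 where d1: "0 < d1" "\<And>x' s. dist x' x < d1 \<Longrightarrow> s \<in> T \<Longrightarrow> dist (M x' s) (M x s) < \<eta>"
        using continuous_on_product_tube [OF I(1) x T(1,2) M \<eta>] by blast
      obtain d2 where d2: "0 < d2" "\<And>x'. dist x' x < d2 \<Longrightarrow> dist (c x') (c x) < \<eta>"
        using has_vector_derivative_continuous [OF c' [OF x]] \<eta> unfolding continuous_at_eps_delta by blast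
      obtain d3 where d3: "0 < d3" "\<And>t'. dist t' t < d3 \<Longrightarrow> dist (y x t') (y x t) < e / 2"
        using has_vector_derivative_continuous [OF yt [OF x t]] half_gt_zero [OF e]
        unfolding continuous_at_eps_delta by blast
      define d where "d = min (min d1 d2) (min d3 (min a r))"
      have "dist (y x' t') (y x t) < e" if near: "dist (x', t') (x, t) < d" for x' t'
      proof -
        have x'd: "dist x' x < d" and t'd: "dist t' t < d"
          using near order_le_less_trans [OF dist_fst_le near] order_le_less_trans [OF dist_snd_le near]
          by auto
        have x'I: "x' \<in> I" "x' \<in> cball x r"
          using x'd r by (auto simp: d_def dist_commute)
        have t': "t' \<in> T" using t'd uw by (auto simp: T_def d_def dist_real_def)
        have seg: "closed_segment t0 t' \<subseteq> T"
          using t' T(3) by (auto simp: T_def closed_segment_eq_real_ivl)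
        have "norm (y x' t' - y x t') \<le> \<eta> * Q"
          unfolding Q_def
        proof (rule gronwall_linear_scaled [OF C(1), where a = t0 and E = "\<lambda>s. y x' s - y x s"
              and E' = "\<lambda>s. blinfun_apply (M x' s) (y x' s - y x s) + blinfun_apply (M x' s - M x s) (y x s)"])
          show "0 \<le> \<eta>" using \<eta> by simp
          show "norm (y x' t0 - y x t0) \<le> \<eta>"
            using d2(2) [of x'] x'd by (simp add: y0 x x'I d_def dist_norm less_imp_le)
          show "\<bar>t' - t0\<bar> \<le> w - u" using t' T(3) by (auto simp: T_def)
          fix s assume "s \<in> closed_segment t0 t'"
          then have s: "s \<in> T" "s \<in> J" using T seg by auto
          have "((\<lambda>s. y x' s - y x s) has_vector_derivative blinfun_apply (M x' s) (y x' s) - blinfun_apply (M x s) (y x s)) (at s)"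
            by (intro has_vector_derivative_diff yt x x'I s)
          then show "((\<lambda>s. y x' s - y x s) has_vector_derivative
              blinfun_apply (M x' s) (y x' s - y x s) + blinfun_apply (M x' s - M x s) (y x s)) (at s)"
            by (simp add: blinfun.bilinear_simps)
          have "norm (blinfun_apply (M x' s) (y x' s - y x s) + blinfun_apply (M x' s - M x s) (y x s))
              \<le> norm (M x' s) * norm (y x' s - y x s) + norm (M x' s - M x s) * norm (y x s)"
            by (intro norm_triangle_mono norm_blinfun)
          also have "\<dots> \<le> C * norm (y x' s - y x s) + \<eta> * B"
          proof (intro add_mono mult_mono)
            show "norm (M x' s) \<le> C" by (rule C(2) [OF x'I(2) s(1)])
            show "norm (M x' s - M x s) \<le> \<eta>"
              using d1(2) [of x' s] x'd s by (simp add: d_def dist_norm)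
          qed (use C(1) \<eta> B s in simp_all)
          finally show "norm (blinfun_apply (M x' s) (y x' s - y x s) + blinfun_apply (M x' s - M x s) (y x s))
              \<le> C * norm (y x' s - y x s) + B * \<eta>" by (simp add: mult.commute)
        qed
        then have "dist (y x' t') (y x t') \<le> e / 2" using Q by (simp add: dist_norm \<eta>_def)
        moreover have "dist (y x t') (y x t) < e / 2" using d3(2) t'd by (simp add: d_def)
        ultimately show ?thesis
          using dist_triangle [of "y x' t'" "y x t" "y x t'"] by linarith
      qed
      moreover have "0 < d" using d1 d2 d3 r a by (simp add: d_def)
      ultimately show "\<exists>d>0. \<forall>p. dist p (x, t) < d \<longrightarrow>
          dist ((\<lambda>(x, t). y x t) p) ((\<lambda>(x, t). y x t) (x, t)) < e"
        by auto
    qed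
  qed
  then have "continuous_on (I \<times> J) (\<lambda>(x, t). y x t)"
    by (auto intro!: continuous_at_imp_continuous_on)
  moreover have "y x0 t0 = y0" using y0 [OF I(3)] c by simp
  ultimately show thesis using yx yt by (intro that [of y])
qed

text \<open>Only continuity along lines is required of the coefficients, since the value at
  \<open>(x, t)\<close> is reached from the base point along one horizontal and one vertical segment.\<close>

lemma linear_pde_unique_on_box:
  fixes L M :: "real \<Rightarrow> real \<Rightarrow> 'a::euclidean_space \<Rightarrow>\<^sub>L 'a"
  assumes I: "is_interval I" "x0 \<in> I" "x \<in> I" and J: "is_interval J" "t0 \<in> J" "t \<in> J"
    and L: "continuous_on I (\<lambda>x. L x t0)" and M: "continuous_on J (\<lambda>t. M x t)"
    and yx: "\<And>x. x \<in> I \<Longrightarrow> ((\<lambda>s. y s t0) has_vector_derivative L x t0 (y x t0)) (at x)"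
    and yt: "\<And>t. t \<in> J \<Longrightarrow> ((\<lambda>s. y x s) has_vector_derivative M x t (y x t)) (at t)"
    and zx: "\<And>x. x \<in> I \<Longrightarrow> ((\<lambda>s. z s t0) has_vector_derivative L x t0 (z x t0)) (at x)"
    and zt: "\<And>t. t \<in> J \<Longrightarrow> ((\<lambda>s. z x s) has_vector_derivative M x t (z x t)) (at t)"
    and init: "y x0 t0 = z x0 t0"
  shows "y x t = z x t"
proof (rule linear_ode_unique [OF J M yt zt])
  show "y x t0 = z x t0"
    by (rule linear_ode_unique [OF I L yx zx init])
qed

section \<open>Calculus of complex matrices\<close>

text \<open>The scalar multiplication of complex matrices commutes with all products; moving scalars
  to the front and products to left-nested form gives a normal form in which identities
  between noncommutative words become linear.\<close>

lemma cscale_simps: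
  fixes M N :: "complex^'n^'m"
  shows cscale_nth: "(c *\<^sub>m M) $ i $ k = c * M $ i $ k"
    and cscale_add_right: "c *\<^sub>m (M + N) = c *\<^sub>m M + c *\<^sub>m N"
    and cscale_diff_right: "c *\<^sub>m (M - N) = c *\<^sub>m M - c *\<^sub>m N"
    and cscale_minus_right: "c *\<^sub>m (- M) = - (c *\<^sub>m M)"
    and cscale_minus_left: "(- c) *\<^sub>m M = - (c *\<^sub>m M)"
    and cscale_cscale: "c *\<^sub>m d *\<^sub>m M = (c * d) *\<^sub>m M"
    and cscale_one: "1 *\<^sub>m M = M"
    and cscale_zero: "c *\<^sub>m (0 :: complex^'n^'m) = 0"
  by (simp_all add: cscale_def vec_eq_iff algebra_simps)

lemma cscale_matrix_mult:
  fixes M :: "complex^'k^'m" and N :: "complex^'n^'k"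
  shows "(c *\<^sub>m M) ** N = c *\<^sub>m (M ** N)" and "M ** (c *\<^sub>m N) = c *\<^sub>m (M ** N)"
  by (simp_all add: cscale_def matrix_matrix_mult_def vec_eq_iff sum_distrib_left mult_ac)

lemma matrix_mult_add_diff_minus:
  fixes M M' :: "complex^'k^'m" and N N' :: "complex^'n^'k"
  shows "(M + M') ** N = M ** N + M' ** N" and "(M - M') ** N = M ** N - M' ** N" and "M ** (N - N') = M ** N - M ** N'"
    and "(- M) ** N = - (M ** N)" and "M ** (- N) = - (M ** N)"
    and "0 ** N = 0" and "M ** 0 = 0"
  by (simp_all add: matrix_matrix_mult_def vec_eq_iff algebra_simps sum_subtractf sum_negf sum.distrib)

lemmas matrix_algebra_simps = matrix_mul_assoc matrix_add_ldistrib
  matrix_mult_add_diff_minus cscale_matrix_mult cscale_add_right cscale_diff_right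
  cscale_minus_right cscale_minus_left cscale_cscale cscale_one cscale_zero

lemma conj_transpose_nth: "(M\<^sup>H) $ i $ k = cnj (M $ k $ i)"
  by (simp add: conj_transpose_def)

lemma conj_transpose_simps:
  fixes M M' :: "complex^'k^'m" and N :: "complex^'n^'k"
  shows "(M ** N)\<^sup>H = N\<^sup>H ** M\<^sup>H" and "(c *\<^sub>m M)\<^sup>H = cnj c *\<^sub>m M\<^sup>H"
    and "(M + M')\<^sup>H = M\<^sup>H + M'\<^sup>H" and "(M - M')\<^sup>H = M\<^sup>H - M'\<^sup>H"
    and "(- M)\<^sup>H = - (M\<^sup>H)" and "(M\<^sup>H)\<^sup>H = M"
  by (simp_all add: conj_transpose_def cscale_def matrix_matrix_mult_def vec_eq_iff mult.commute)

lemma conj_transpose_mat: "(mat c :: complex^'n^'n)\<^sup>H = mat (cnj c)"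
  by (simp add: conj_transpose_def mat_def vec_eq_iff)

lemma matrix_mult_scaleR:
  fixes M :: "complex^'k^'m" and N :: "complex^'n^'k"
  shows "(r *\<^sub>R M) ** N = r *\<^sub>R (M ** N)" and "M ** (r *\<^sub>R N) = r *\<^sub>R (M ** N)"
  by (simp_all add: matrix_matrix_mult_def vec_eq_iff scaleR_sum_right)

lemma bounded_bilinear_matrix_mult:
  "bounded_bilinear ((**) :: complex^'k^'m \<Rightarrow> complex^'n^'k \<Rightarrow> complex^'n^'m)"
  unfolding bilinear_conv_bounded_bilinear [symmetric] bilinear_def
  by (auto intro!: linearI simp: matrix_add_ldistrib matrix_mult_add_diff_minus(1) matrix_mult_scaleR)

lemma bounded_linear_conj_transpose:
  "bounded_linear (conj_transpose :: complex^'n^'m \<Rightarrow> complex^'m^'n)"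
  unfolding linear_conv_bounded_linear [symmetric]
  by (auto intro!: linearI simp: conj_transpose_def vec_eq_iff)

lemma bounded_linear_cscale: "bounded_linear (\<lambda>M :: complex^'n^'m. c *\<^sub>m M)"
  unfolding linear_conv_bounded_linear [symmetric]
  by (auto intro!: linearI simp: cscale_def vec_eq_iff algebra_simps)

lemmas has_vector_derivative_matrix_mult =
  bounded_bilinear.has_vector_derivative [OF bounded_bilinear_matrix_mult]
lemmas has_vector_derivative_conj_transpose =
  bounded_linear.has_vector_derivative [OF bounded_linear_conj_transpose]
lemmas has_vector_derivative_cscale =
  bounded_linear.has_vector_derivative [OF bounded_linear_cscale]
lemmas continuous_on_matrix_mult =
  bounded_bilinear.continuous_on [OF bounded_bilinear_matrix_mult]
lemmas continuous_on_conj_transpose =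
  bounded_linear.continuous_on [OF bounded_linear_conj_transpose]
lemmas continuous_on_cscale =
  bounded_linear.continuous_on [OF bounded_linear_cscale]

lemma matrix_inv_cancel:
  fixes M :: "complex^'n^'n"
  assumes "invertible M"
  shows "M ** matrix_inv M = mat 1" and "matrix_inv M ** M = mat 1"
  using someI_ex [OF assms [unfolded invertible_def]] by (auto simp: matrix_inv_def)

lemma matrix_inv_cancel_middle:
  fixes M :: "complex^'n^'n" and N :: "complex^'n^'m"
  assumes "invertible M"
  shows "N ** M ** matrix_inv M = N" and "N ** matrix_inv M ** M = N"
  using matrix_inv_cancel [OF assms]
  by (simp_all flip: matrix_mul_assoc)

lemma matrix_inv_unique:
  fixes M N :: "complex^'n^'n"
  assumes "M ** N = mat 1"
  shows "matrix_inv M = N"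
proof -
  have NM: "N ** M = mat 1" using assms by (simp add: matrix_left_right_inverse)
  with assms have "invertible M" unfolding invertible_def by blast
  then have "N ** M ** matrix_inv M = N"
    using matrix_inv_cancel_middle by blast
  with NM show ?thesis by simp
qed

lemma conj_transpose_matrix_inv:
  fixes M :: "complex^'n^'n"
  assumes "invertible M"
  shows "(matrix_inv M)\<^sup>H = matrix_inv (M\<^sup>H)" and "invertible (M\<^sup>H)"
proof -
  have *: "M\<^sup>H ** (matrix_inv M)\<^sup>H = mat 1"
    using matrix_inv_cancel(2) [OF assms]
    by (simp add: conj_transpose_mat flip: conj_transpose_simps(1))
  then show "(matrix_inv M)\<^sup>H = matrix_inv (M\<^sup>H)" by (rule matrix_inv_unique [symmetric])
  show "invertible (M\<^sup>H)"
    using * matrix_left_right_inverse unfolding invertible_def by blast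
qed

lemma tendsto_det:
  fixes f :: "'a \<Rightarrow> complex^'n^'n"
  assumes "(f \<longlongrightarrow> M) F"
  shows "((\<lambda>x. det (f x)) \<longlongrightarrow> det M) F"
  unfolding det_def by (intro tendsto_intros assms)

lemma eventually_invertible:
  fixes f :: "'a \<Rightarrow> complex^'n^'n"
  assumes "(f \<longlongrightarrow> M) F" and "invertible M"
  shows "\<forall>\<^sub>F x in F. invertible (f x)"
  using tendsto_imp_eventually_ne [OF tendsto_det [OF assms(1)], of 0] assms(2)
  by (simp add: invertible_det_nz)

text \<open>From \<open>X\<inverse> - M\<inverse> = - X\<inverse> (X - M) M\<inverse>\<close>: for \<open>X\<close> close to \<open>M\<close> this first bounds
  the norm of \<open>X\<inverse>\<close> by twice that of \<open>M\<inverse>\<close>, and then makes the difference small.\<close>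

lemma tendsto_matrix_inv:
  fixes f :: "'a \<Rightarrow> complex^'n^'n"
  assumes f: "(f \<longlongrightarrow> M) F" and M: "invertible M"
  shows "((\<lambda>x. matrix_inv (f x)) \<longlongrightarrow> matrix_inv M) F"
proof -
  obtain K where K: "K > 0" "\<And>(X :: complex^'n^'n) (Y :: complex^'n^'n). norm (X ** Y) \<le> norm X * norm Y * K"
    using bounded_bilinear.pos_bounded [OF bounded_bilinear_matrix_mult] by blast
  have K3: "norm (X ** Y ** Z) \<le> norm X * norm Y * norm Z * K\<^sup>2" for X Y Z :: "complex^'n^'n"
  proof -
    have "norm (X ** Y ** Z) \<le> norm (X ** Y) * norm Z * K" using K(2) [of "X ** Y" Z] .
    also have "\<dots> \<le> norm X * norm Y * K * norm Z * K"
      using K by (intro mult_right_mono) auto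
    finally show ?thesis by (simp add: power2_eq_square mult_ac)
  qed
  define c where "c = norm (matrix_inv M) * K\<^sup>2"
  have lim: "((\<lambda>x. norm (f x - M) * c) \<longlongrightarrow> 0) F"
    using tendsto_mult_left_zero [OF tendsto_norm_zero [OF Lim_null [THEN iffD1, OF f]]] .
  have small: "\<forall>\<^sub>F x in F. norm (f x - M) * c < 1 / 2"
    using order_tendstoD(2) [OF lim, of "1 / 2"] by simp
  have "\<forall>\<^sub>F x in F. norm (matrix_inv (f x) - matrix_inv M)
      \<le> norm (f x - M) * c * (2 * norm (matrix_inv M))"
    using small eventually_invertible [OF f M]
  proof eventually_elim
    case (elim x)
    have "matrix_inv (f x) - matrix_inv M = - (matrix_inv (f x) ** (f x - M) ** matrix_inv M)"
      using elim M
      by (simp add: matrix_algebra_simps matrix_inv_cancel matrix_inv_cancel_middle)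
    then have *: "norm (matrix_inv (f x) - matrix_inv M) \<le> norm (matrix_inv (f x)) * (norm (f x - M) * c)"
      using K3 [of "matrix_inv (f x)" "f x - M" "matrix_inv M"] by (simp add: c_def mult_ac)
    also have "\<dots> \<le> norm (matrix_inv (f x)) * (1 / 2)"
      using elim by (intro mult_left_mono) auto
    finally have "norm (matrix_inv (f x)) \<le> 2 * norm (matrix_inv M)"
      using norm_triangle_ineq2 [of "matrix_inv (f x)" "matrix_inv M"] by simp
    then have "norm (matrix_inv (f x)) * (norm (f x - M) * c) \<le> 2 * norm (matrix_inv M) * (norm (f x - M) * c)"
      using K by (intro mult_right_mono) (auto simp: c_def)
    with * show ?case by (simp add: mult_ac)
  qed
  moreover have "((\<lambda>x. norm (f x - M) * c * (2 * norm (matrix_inv M))) \<longlongrightarrow> 0) F"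
    by (rule tendsto_mult_left_zero [OF lim])
  ultimately have "((\<lambda>x. matrix_inv (f x) - matrix_inv M) \<longlongrightarrow> 0) F"
    by (rule Lim_null_comparison)
  then show ?thesis by (rule Lim_null [THEN iffD2])
qed

lemma has_vector_derivative_iff_quotient:
  fixes f :: "real \<Rightarrow> 'a::real_normed_vector"
  shows "(f has_vector_derivative f') (at t) \<longleftrightarrow>
    ((\<lambda>s. (f s - f t) /\<^sub>R (s - t)) \<longlongrightarrow> f') (at t)"
proof -
  have eq: "norm (f s - f t - (s - t) *\<^sub>R f') / norm (s - t) = norm ((f s - f t) /\<^sub>R (s - t) - f')"
    if "s \<noteq> t" for s
  proof -
    have "(f s - f t) /\<^sub>R (s - t) - f' = (f s - f t - (s - t) *\<^sub>R f') /\<^sub>R (s - t)"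
      using that by (simp add: scaleR_diff_right)
    then show ?thesis by (simp add: divide_inverse_commute)
  qed
  have "(f has_vector_derivative f') (at t) \<longleftrightarrow>
      ((\<lambda>s. norm (f s - f t - (s - t) *\<^sub>R f') / norm (s - t)) \<longlongrightarrow> 0) (at t)"
    by (simp add: has_vector_derivative_def has_derivative_iff_norm bounded_linear_scaleR_left)
  also have "\<dots> \<longleftrightarrow> ((\<lambda>s. norm ((f s - f t) /\<^sub>R (s - t) - f')) \<longlongrightarrow> 0) (at t)"
    by (intro filterlim_cong refl) (use eq in \<open>auto simp: eventually_at_filter\<close>)
  also have "\<dots> \<longleftrightarrow> ((\<lambda>s. (f s - f t) /\<^sub>R (s - t)) \<longlongrightarrow> f') (at t)"
    by (simp add: tendsto_norm_zero_iff Lim_null [symmetric])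
  finally show ?thesis .
qed

text \<open>The difference quotient of the inverse equals
  \<open>- f(s)\<inverse> ((f(s) - f(t)) / (s - t)) f(t)\<inverse>\<close>, so continuity of the inverse suffices.\<close>

lemma has_vector_derivative_matrix_inv:
  fixes f :: "real \<Rightarrow> complex^'n^'n"
  assumes f: "(f has_vector_derivative f') (at t)" and inv: "invertible (f t)"
  shows "((\<lambda>s. matrix_inv (f s)) has_vector_derivative
          - (matrix_inv (f t) ** f' ** matrix_inv (f t))) (at t)"
  unfolding has_vector_derivative_iff_quotient
proof (rule Lim_transform_eventually)
  have cont: "(f \<longlongrightarrow> f t) (at t)"
    using has_vector_derivative_continuous [OF f] by (simp add: isCont_def)
  show "((\<lambda>s. - (matrix_inv (f s) ** ((f s - f t) /\<^sub>R (s - t)) ** matrix_inv (f t)))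
      \<longlongrightarrow> - (matrix_inv (f t) ** f' ** matrix_inv (f t))) (at t)"
    by (intro tendsto_minus bounded_bilinear.tendsto [OF bounded_bilinear_matrix_mult]
        tendsto_const tendsto_matrix_inv [OF cont inv] f [unfolded has_vector_derivative_iff_quotient])
  show "\<forall>\<^sub>F s in at t. - (matrix_inv (f s) ** ((f s - f t) /\<^sub>R (s - t)) ** matrix_inv (f t))
      = (matrix_inv (f s) - matrix_inv (f t)) /\<^sub>R (s - t)"
    using eventually_invertible [OF cont inv]
  proof eventually_elim
    case (elim s)
    have "matrix_inv (f s) ** (f s - f t) ** matrix_inv (f t) = matrix_inv (f t) - matrix_inv (f s)"
      using elim inv by (simp add: matrix_algebra_simps matrix_inv_cancel matrix_inv_cancel_middle)
    then show ?case
      by (simp add: matrix_mult_scaleR flip: scaleR_minus_right)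
  qed
qed

section \<open>Algebra of the dressing factor\<close>

lemma mat_mult_cscale:
  fixes M :: "complex^'n^'m"
  shows "mat c ** M = c *\<^sub>m M" and "M ** mat c = c *\<^sub>m M"
  by (simp_all add: matrix_matrix_mult_def mat_def cscale_def vec_eq_iff if_distrib if_distribR
      sum.delta sum.delta' mult.commute cong: if_cong)

text \<open>The Sylvester identity multiplied by \<open>S\<inverse>\<close> on both sides. It moves \<open>A'\<close> past
  \<open>S\<inverse>\<close> at the cost of a term of rank at most two.\<close>

lemma sylvester_inverse_form:
  fixes A A' S :: "complex^'n^'n" and P :: "complex^2^'n" and C :: "complex^'n^2"
  assumes S: "invertible S" and syl: "A ** S - S ** A' = \<i> *\<^sub>m (P ** C)"
  shows "A' ** matrix_inv S = matrix_inv S ** A - \<i> *\<^sub>m (matrix_inv S ** P ** C ** matrix_inv S)"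
proof -
  have "matrix_inv S ** (A ** S - S ** A') ** matrix_inv S = matrix_inv S ** A - A' ** matrix_inv S"
    using S by (simp add: matrix_algebra_simps matrix_inv_cancel matrix_inv_cancel_middle)
  then show ?thesis by (simp add: syl matrix_algebra_simps algebra_simps)
qed

text \<open>The transfer matrix function of a Sylvester identity has an inverse of the same form.
  With \<open>A\<close> and \<open>A'\<close> shifted by \<open>\<lambda>\<close> this shows that the Darboux matrix is invertible; at \<open>\<lambda> = 0\<close> it
  says that \<open>1 + Y\<close> is the inverse of \<open>1 - X\<close>.\<close>

lemma darboux_factor_inverse:
  fixes A A' S :: "complex^'n^'n" and P :: "complex^2^'n" and C :: "complex^'n^2"
  assumes inv: "invertible S" "invertible A" "invertible A'"
    and syl: "A ** S - S ** A' = \<i> *\<^sub>m (P ** C)"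
  defines "W \<equiv> mat 1 - \<i> *\<^sub>m (C ** matrix_inv S ** matrix_inv A ** P)"
    and "W' \<equiv> mat 1 + \<i> *\<^sub>m (C ** matrix_inv A' ** matrix_inv S ** P)"
  shows "W ** (C ** matrix_inv A' ** matrix_inv S) = C ** matrix_inv S ** matrix_inv A"
    and "W ** W' = mat 1" and "W' ** W = mat 1"
proof -
  have "C ** matrix_inv S ** matrix_inv A ** (A ** S - S ** A') ** matrix_inv A' ** matrix_inv S
      = C ** matrix_inv A' ** matrix_inv S - C ** matrix_inv S ** matrix_inv A"
    using inv by (simp add: matrix_algebra_simps matrix_inv_cancel matrix_inv_cancel_middle)
  then have resolvent: "\<i> *\<^sub>m (C ** matrix_inv S ** matrix_inv A ** P ** C ** matrix_inv A' ** matrix_inv S)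
      = C ** matrix_inv A' ** matrix_inv S - C ** matrix_inv S ** matrix_inv A"
    by (simp add: syl matrix_algebra_simps)
  show 1: "W ** (C ** matrix_inv A' ** matrix_inv S) = C ** matrix_inv S ** matrix_inv A"
    by (simp add: W_def matrix_algebra_simps resolvent)
  have "W ** W' = W + \<i> *\<^sub>m (W ** (C ** matrix_inv A' ** matrix_inv S) ** P)"
    by (simp add: W'_def matrix_algebra_simps)
  also have "\<dots> = mat 1" by (simp add: 1) (simp add: W_def)
  finally show "W ** W' = mat 1" .
  then show "W' ** W = mat 1" by (simp add: matrix_left_right_inverse)
qed

text \<open>The left-hand side is the \<open>x\<close>-derivative of \<open>B = C S\<inverse>\<close> by the product rule. Moving
  \<open>A'\<close> past \<open>S\<inverse>\<close> produces one term of the commutator of \<open>q\<close> and \<open>X\<close>, the derivative of \<open>S\<close> the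
  other term.\<close>

lemma dressing_x_identity:
  fixes A A' S :: "complex^'n^'n" and P :: "complex^2^'n" and C :: "complex^'n^2"
  assumes S: "invertible S" and syl: "A ** S - S ** A' = \<i> *\<^sub>m (P ** C)"
    and B: "B = C ** matrix_inv S" and X: "X = \<i> *\<^sub>m (B ** P)"
  shows "(- (q ** C ** A') - q' ** C) ** matrix_inv S
           + C ** (- (matrix_inv S ** (\<i> *\<^sub>m (P ** q ** C)) ** matrix_inv S))
         = - (q ** B ** A) - (q' - (q ** X - X ** q)) ** B"
proof -
  have "q ** C ** A' ** matrix_inv S = q ** C ** (A' ** matrix_inv S)"
    by (simp add: matrix_mul_assoc)
  then have "q ** C ** A' ** matrix_inv S
      = q ** C ** matrix_inv S ** A - \<i> *\<^sub>m (q ** C ** matrix_inv S ** P ** C ** matrix_inv S)"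
    by (simp add: sylvester_inverse_form [OF S syl] matrix_algebra_simps)
  then show ?thesis
    by (simp add: B X matrix_algebra_simps algebra_simps)
qed

text \<open>The left-hand side is the \<open>t\<close>-derivative of \<open>B = C S\<inverse>\<close>. The product rule gives
  \<open>- (1 - X) Q C A'\<inverse> S\<inverse>\<close>, and \<open>C A'\<inverse> S\<inverse> = (1 + Y) B A\<inverse>\<close>.\<close>

lemma dressing_t_identity:
  fixes A A' S :: "complex^'n^'n" and P :: "complex^2^'n" and C :: "complex^'n^2"
  assumes inv: "invertible S" "invertible A" "invertible A'"
    and syl: "A ** S - S ** A' = \<i> *\<^sub>m (P ** C)"
    and B: "B = C ** matrix_inv S" and X: "X = \<i> *\<^sub>m (B ** matrix_inv A ** P)"
    and Y: "Y = \<i> *\<^sub>m (C ** matrix_inv A' ** matrix_inv S ** P)"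
    and Q': "Q' = (mat 1 - X) ** Q ** (mat 1 + Y)"
  shows "- (Q ** C ** matrix_inv A') ** matrix_inv S
           + C ** (- (matrix_inv S ** ((- \<i>) *\<^sub>m (matrix_inv A ** P ** Q ** C ** matrix_inv A')) ** matrix_inv S))
         = - (Q' ** B ** matrix_inv A)"
proof -
  let ?C = "C ** matrix_inv A' ** matrix_inv S"
  have 1: "(mat 1 - X) ** ?C = B ** matrix_inv A"
    and 2: "(mat 1 + Y) ** (mat 1 - X) = mat 1"
    using darboux_factor_inverse(1,3) [OF inv syl] by (simp_all add: B X Y)
  have "Q' ** B ** matrix_inv A = Q' ** ((mat 1 - X) ** ?C)"
    by (simp only: 1) (simp only: matrix_mul_assoc)
  also have "\<dots> = (mat 1 - X) ** Q ** ((mat 1 + Y) ** (mat 1 - X)) ** ?C"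
    by (simp only: Q' matrix_mul_assoc)
  finally have "Q' ** B ** matrix_inv A = (mat 1 - X) ** Q ** ?C" by (simp add: 2)
  then show ?thesis
    by (simp add: X B matrix_algebra_simps algebra_simps)
qed

text \<open>The left-hand side is the \<open>x\<close>-derivative of \<open>W\<close>. The resolvent identity
  \<open>A R = R A = 1 + \<mu> R\<close> removes \<open>A\<close>; the terms without \<open>R\<close> form the commutator \<open>[q, X]\<close>, which the
  definition of the dressed coefficient \<open>r\<close> absorbs.\<close>

lemma darboux_x_identity:
  fixes A R :: "complex^'n^'n" and P :: "complex^2^'n" and B :: "complex^'n^2"
  assumes R: "R ** (A - mat \<mu>) = mat 1" "(A - mat \<mu>) ** R = mat 1"
    and X: "X = \<i> *\<^sub>m (B ** P)" and W: "W = mat 1 - \<i> *\<^sub>m (B ** R ** P)"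
    and r: "r = q' - (q ** X - X ** q)"
  shows "- (\<i> *\<^sub>m ((- (q ** B ** A) - r ** B) ** R ** P + B ** R ** (A ** P ** q + P ** q')))
         = W ** (\<mu> *\<^sub>m q + q') - (\<mu> *\<^sub>m q + r) ** W"
proof -
  have AR: "A ** R = mat 1 + \<mu> *\<^sub>m R" and RA: "R ** A = mat 1 + \<mu> *\<^sub>m R"
    using R by (simp_all add: matrix_algebra_simps mat_mult_cscale algebra_simps)
  have "q ** B ** A ** R ** P = q ** B ** (A ** R) ** P" "B ** R ** A ** P ** q = B ** (R ** A) ** P ** q"
    by (simp_all add: matrix_mul_assoc)
  then show ?thesis
    by (simp add: AR RA W X r matrix_algebra_simps algebra_simps)
qed

text \<open>The counterpart for \<open>t\<close>, with the resolvent identity in the form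
  \<open>A\<inverse> R = R A\<inverse> = (R - A\<inverse>) / \<mu>\<close>; the terms with \<open>A\<inverse>\<close> cancel by the intertwining hypothesis.\<close>

lemma darboux_t_identity:
  fixes A R :: "complex^'n^'n" and P :: "complex^2^'n" and B :: "complex^'n^2"
  assumes R: "R ** (A - mat \<mu>) = mat 1" "(A - mat \<mu>) ** R = mat 1" and A: "invertible A"
    and X: "X = \<i> *\<^sub>m (B ** matrix_inv A ** P)" and W: "W = mat 1 - \<i> *\<^sub>m (B ** R ** P)"
    and \<mu>: "\<mu> \<noteq> 0" and Q': "Q' ** (mat 1 - X) = (mat 1 - X) ** Q"
  shows "- (\<i> *\<^sub>m (- (Q' ** B ** matrix_inv A) ** R ** P + B ** R ** (matrix_inv A ** P ** Q)))
         = (1 / \<mu>) *\<^sub>m (W ** Q - Q' ** W)"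
proof -
  have "A ** R = mat 1 + \<mu> *\<^sub>m R" and "R ** A = mat 1 + \<mu> *\<^sub>m R"
    using R by (simp_all add: matrix_algebra_simps mat_mult_cscale algebra_simps)
  then have "matrix_inv A ** (A ** R) = matrix_inv A + \<mu> *\<^sub>m (matrix_inv A ** R)"
    and "(R ** A) ** matrix_inv A = matrix_inv A + \<mu> *\<^sub>m (R ** matrix_inv A)"
    by (simp_all add: matrix_algebra_simps)
  then have "R = matrix_inv A + \<mu> *\<^sub>m (matrix_inv A ** R)"
    and "R = matrix_inv A + \<mu> *\<^sub>m (R ** matrix_inv A)"
    using A by (simp_all add: matrix_mul_assoc matrix_inv_cancel matrix_inv_cancel_middle)
  then have "(1 / \<mu>) *\<^sub>m (R - matrix_inv A) = (1 / \<mu>) *\<^sub>m (\<mu> *\<^sub>m (matrix_inv A ** R))"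
    and "(1 / \<mu>) *\<^sub>m (R - matrix_inv A) = (1 / \<mu>) *\<^sub>m (\<mu> *\<^sub>m (R ** matrix_inv A))"
    by (metis add_diff_cancel_left')+
  then have AR: "matrix_inv A ** R = (1 / \<mu>) *\<^sub>m (R - matrix_inv A)"
    and RA: "R ** matrix_inv A = (1 / \<mu>) *\<^sub>m (R - matrix_inv A)"
    using \<mu> by (simp_all only: cscale_cscale) (simp_all add: cscale_one)
  have "Q' ** B ** matrix_inv A ** R ** P = Q' ** B ** (matrix_inv A ** R) ** P"
    "B ** R ** matrix_inv A ** P ** Q = B ** (R ** matrix_inv A) ** P ** Q"
    by (simp_all add: matrix_mul_assoc)
  then have words: "Q' ** B ** matrix_inv A ** R ** P
        = (1 / \<mu>) *\<^sub>m (Q' ** B ** R ** P) - (1 / \<mu>) *\<^sub>m (Q' ** B ** matrix_inv A ** P)"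
      "B ** R ** matrix_inv A ** P ** Q
        = (1 / \<mu>) *\<^sub>m (B ** R ** P ** Q) - (1 / \<mu>) *\<^sub>m (B ** matrix_inv A ** P ** Q)"
    by (simp_all add: AR RA matrix_algebra_simps)
  have "Q' - Q' ** X = Q - X ** Q"
    using Q' by (simp add: matrix_algebra_simps)
  then have "(1 / \<mu>) *\<^sub>m (Q' - \<i> *\<^sub>m (Q' ** B ** matrix_inv A ** P))
      = (1 / \<mu>) *\<^sub>m (Q - \<i> *\<^sub>m (B ** matrix_inv A ** P ** Q))"
    by (simp add: X matrix_algebra_simps)
  then show ?thesis
    by (simp add: words W matrix_algebra_simps algebra_simps)
qed

section \<open>The two-by-two coefficient matrices\<close>

text \<open>The matrix \<open>q\<^sub>0\<close> for the value \<open>v = z\<close>.\<close>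

definition q_potential :: "nat \<Rightarrow> complex \<Rightarrow> complex^2^2" where
  "q_potential p z = (\<i> / 2) *\<^sub>m (jpow (Suc p) ** Vmat z)"

text \<open>The matrix \<open>Q\<^sub>-\<^sub>1\<close> for the values \<open>\<rho> = r\<close> and \<open>v\<^sub>t = u\<close>. The auxiliary systems have
  coefficients \<open>- (\<lambda> q\<^sub>1 + q\<^sub>0)\<close> and \<open>- Q\<^sub>-\<^sub>1 / \<lambda>\<close>, so these two matrices carry all equations.\<close>

definition Q_potential :: "nat \<Rightarrow> complex \<Rightarrow> complex \<Rightarrow> complex^2^2" where
  "Q_potential p r u = (\<i> * r) *\<^sub>m jmat - jpow p ** Vmat u"

lemma coefficient_matrices:
  "q0 p v x t = q_potential p (v x t)"
  "Qm1 p \<rho> v x t = Q_potential p (\<rho> x t) (dt v x t)"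
  "Gmat p lam v x t = - (lam *\<^sub>m q1 + q_potential p (v x t))"
  "Fmat p lam \<rho> v x t = - ((1 / lam) *\<^sub>m Q_potential p (\<rho> x t) (dt v x t))"
  by (simp_all add: q0_def q_potential_def Qm1_def Q_potential_def Gmat_def Fmat_def q1_def
      matrix_algebra_simps vec_eq_iff cscale_nth algebra_simps)

lemma matrix_2x2_eq_iff:
  "(M :: complex^2^2) = N \<longleftrightarrow>
    M $ 1 $ 1 = N $ 1 $ 1 \<and> M $ 1 $ 2 = N $ 1 $ 2 \<and> M $ 2 $ 1 = N $ 2 $ 1 \<and> M $ 2 $ 2 = N $ 2 $ 2"
  by (auto simp: vec_eq_iff forall_2)

lemma matrix_2x2_mult_nth: "((M :: complex^2^'m) ** (N :: complex^'n^2)) $ i $ k = M $ i $ 1 * N $ 1 $ k + M $ i $ 2 * N $ 2 $ k"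
  by (simp add: matrix_matrix_mult_def sum_2)

lemma jmat_nth [simp]: "jmat $ 1 $ 1 = 1" "jmat $ 1 $ 2 = 0" "jmat $ 2 $ 1 = 0" "jmat $ 2 $ 2 = -1"
  by (simp_all add: jmat_def)

lemma q1_nth [simp]: "q1 $ 1 $ 1 = - \<i> / 4" "q1 $ 1 $ 2 = 0" "q1 $ 2 $ 1 = 0" "q1 $ 2 $ 2 = \<i> / 4"
  by (simp_all add: q1_def cscale_nth)

lemma q1_conj_transpose: "q1\<^sup>H = - q1"
  by (simp add: matrix_2x2_eq_iff conj_transpose_nth)

lemma linear_q_potential: "bounded_linear (q_potential p)"
  unfolding linear_conv_bounded_linear [symmetric]
  by (auto intro!: linearI simp: q_potential_def Vmat_def matrix_2x2_eq_iff matrix_2x2_mult_nth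
      cscale_nth algebra_simps)

lemma linear_Q_potential: "bounded_linear (\<lambda>(r, u). Q_potential p r u)"
  unfolding linear_conv_bounded_linear [symmetric]
  by (auto intro!: linearI simp: Q_potential_def Vmat_def matrix_2x2_eq_iff matrix_2x2_mult_nth
      cscale_nth algebra_simps)

locale ccd_sign =
  fixes \<kappa> :: real and p :: nat
  assumes \<kappa>: "\<kappa> \<in> {1, - 1}" and p: "real p = (1 + \<kappa>) / 2"
begin

abbreviation J :: "complex^2^2" where "J \<equiv> jpow (Suc p)"

lemma sign_cases: obtains "\<kappa> = 1" "p = 1" | "\<kappa> = - 1" "p = 0"
  using \<kappa> p by auto

lemma jpow_nth [simp]:
  "J $ 1 $ 1 = 1" "J $ 1 $ 2 = 0" "J $ 2 $ 1 = 0" "J $ 2 $ 2 = \<kappa>"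
  "jpow p $ 1 $ 1 = 1" "jpow p $ 1 $ 2 = 0" "jpow p $ 2 $ 1 = 0" "jpow p $ 2 $ 2 = - \<kappa>"
  by (cases rule: sign_cases; simp add: matrix_power_def matrix_2x2_mult_nth mat_def)+

lemma \<kappa>_square: "complex_of_real \<kappa> * complex_of_real \<kappa> = 1" "\<kappa> * \<kappa> = 1"
  by (cases rule: sign_cases; simp)+

lemma \<kappa>_square_left: "complex_of_real \<kappa> * (complex_of_real \<kappa> * z) = z"
  by (cases rule: sign_cases; simp)

lemma q_potential_nth [simp]:
  "q_potential p z $ 1 $ 1 = 0" "q_potential p z $ 1 $ 2 = \<i> / 2 * z"
  "q_potential p z $ 2 $ 1 = \<i> / 2 * \<kappa> * cnj z" "q_potential p z $ 2 $ 2 = 0"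
  by (simp_all add: q_potential_def cscale_nth matrix_2x2_mult_nth Vmat_def)

lemma Q_potential_nth [simp]:
  "Q_potential p r u $ 1 $ 1 = \<i> * r" "Q_potential p r u $ 1 $ 2 = - u"
  "Q_potential p r u $ 2 $ 1 = \<kappa> * cnj u" "Q_potential p r u $ 2 $ 2 = - (\<i> * r)"
  by (simp_all add: Q_potential_def cscale_nth matrix_2x2_mult_nth Vmat_def)

lemma J_square: "J ** J = mat 1"
  by (simp add: matrix_2x2_eq_iff matrix_2x2_mult_nth mat_def \<kappa>_square)

lemma J_conj_transpose: "J\<^sup>H = J"
  by (simp add: matrix_2x2_eq_iff conj_transpose_nth)

lemma J_q1: "J ** q1 = q1 ** J"
  by (simp add: matrix_2x2_eq_iff matrix_2x2_mult_nth)

lemma J_q_potential: "J ** (q_potential p z)\<^sup>H = - (q_potential p z ** J)"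
  by (simp add: matrix_2x2_eq_iff matrix_2x2_mult_nth conj_transpose_nth \<kappa>_square \<kappa>_square_left
      mult_ac)

lemma J_Q_potential:
  assumes "cnj r = r"
  shows "J ** (Q_potential p r u)\<^sup>H = - (Q_potential p r u ** J)"
  using assms
  by (simp add: matrix_2x2_eq_iff matrix_2x2_mult_nth conj_transpose_nth \<kappa>_square \<kappa>_square_left
      mult_ac)

text \<open>First zero curvature relation: \<open>q\<^sub>0\<close> is real-linear in \<open>v\<close>, so the left-hand side is its
  \<open>t\<close>-derivative when \<open>u = v\<^sub>t\<close>.\<close>

lemma q_potential_commutator: "q_potential p u = q1 ** Q_potential p r u - Q_potential p r u ** q1"
  by (simp add: matrix_2x2_eq_iff matrix_2x2_mult_nth algebra_simps)

text \<open>Second zero curvature relation: the right-hand side is the \<open>x\<close>-derivative of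
  \<open>Q\<^sub>-\<^sub>1\<close> precisely when \<open>\<rho>\<^sub>x = - \<kappa> Re (cnj v v\<^sub>t)\<close> and \<open>v\<^sub>t\<^sub>x = \<rho> v\<close>.\<close>

lemma Q_potential_commutator:
  assumes "cnj r = r"
  shows "Q_potential p r u ** q_potential p z - q_potential p z ** Q_potential p r u
       = Q_potential p (of_real (- \<kappa> * Re (cnj z * u))) (r * z)"
  using assms
  by (simp add: matrix_2x2_eq_iff matrix_2x2_mult_nth complex_eq_iff field_simps)

lemma J_skew_nth:
  assumes "J ** M\<^sup>H ** J = - M"
  shows "M $ 2 $ 1 = - (\<kappa> * cnj (M $ 1 $ 2))" and "cnj (M $ 2 $ 2) = - (M $ 2 $ 2)"
proof -
  have "(J ** M\<^sup>H ** J) $ 2 $ 1 = (- M) $ 2 $ 1" "(J ** M\<^sup>H ** J) $ 2 $ 2 = (- M) $ 2 $ 2"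
    by (simp_all only: assms)
  then show "M $ 2 $ 1 = - (\<kappa> * cnj (M $ 1 $ 2))" and "cnj (M $ 2 $ 2) = - (M $ 2 $ 2)"
    by (simp_all add: matrix_2x2_mult_nth conj_transpose_nth \<kappa>_square \<kappa>_square_left mult_ac)
qed

text \<open>Commuting with \<open>q\<^sub>1\<close> kills the diagonal of \<open>M\<close>; the symmetry of \<open>M\<close> makes the two
  off-diagonal entries that remain conjugate up to \<open>\<kappa>\<close>, as in \<open>q\<^sub>0\<close>.\<close>

lemma q_potential_dressed:
  assumes "J ** M\<^sup>H ** J = - M"
  shows "q_potential p z - (q1 ** M - M ** q1) = q_potential p (z + M $ 1 $ 2)"
  using J_skew_nth(1) [OF assms]
  by (simp add: matrix_2x2_eq_iff matrix_2x2_mult_nth algebra_simps)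

text \<open>The symmetry and the vanishing trace characterise the matrices of the form \<open>Q\<^sub>-\<^sub>1\<close> among
  all matrices of order two.\<close>

lemma Q_potential_of_J_skew:
  assumes "J ** M\<^sup>H ** J = - M" and "M $ 1 $ 1 + M $ 2 $ 2 = 0"
  shows "M = Q_potential p (\<i> * M $ 2 $ 2) (- M $ 1 $ 2)"
  using J_skew_nth(1) [OF assms(1)] assms(2)
  by (simp add: matrix_2x2_eq_iff eq_neg_iff_add_eq_0 algebra_simps flip: mult.assoc)

end

section \<open>Solvability of the linear systems\<close>

lemma zero_partials_constant:
  fixes f :: "real \<Rightarrow> real \<Rightarrow> 'a::euclidean_space"
  assumes I: "is_interval I" "x0 \<in> I" "x \<in> I" and T: "is_interval T" "t0 \<in> T" "t \<in> T"
    and fx: "\<And>x t. x \<in> I \<Longrightarrow> t \<in> T \<Longrightarrow> ((\<lambda>s. f s t) has_vector_derivative 0) (at x)"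
    and ft: "\<And>x t. x \<in> I \<Longrightarrow> t \<in> T \<Longrightarrow> ((\<lambda>s. f x s) has_vector_derivative 0) (at t)"
  shows "f x t = f x0 t0"
  by (rule linear_pde_unique_on_box [where L = "\<lambda>x t. 0" and M = "\<lambda>x t. 0" and y = f
        and z = "\<lambda>x t. f x0 t0", OF I T])
     (use assms in simp_all)

text \<open>Adjoining a coordinate that stays equal to \<open>1\<close> turns an inhomogeneous term \<open>a\<close> into a
  linear one. The operators of this form compose to \<open>0\<close>.\<close>

definition forcing :: "'a::euclidean_space \<Rightarrow> ('a \<times> real) \<Rightarrow>\<^sub>L ('a \<times> real)" where
  "forcing a = Blinfun (\<lambda>y. (snd y *\<^sub>R a, 0))"

lemma forcing_apply: "blinfun_apply (forcing a) y = (snd y *\<^sub>R a, 0)"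
proof -
  have "bounded_linear (\<lambda>y :: 'a \<times> real. (snd y *\<^sub>R a, 0 :: real))"
    unfolding linear_conv_bounded_linear [symmetric]
    by (auto intro!: linearI simp: scaleR_left_distrib)
  then show ?thesis
    by (simp add: forcing_def bounded_linear_Blinfun_apply)
qed

lemma bounded_linear_forcing: "bounded_linear forcing"
  unfolding linear_conv_bounded_linear [symmetric]
  by (auto intro!: linearI blinfun_eqI simp: forcing_apply blinfun.bilinear_simps scaleR_right_distrib)

text \<open>The homogeneous Frobenius theorem for \<open>forcing\<close>: the commutator term vanishes, and the
  compatibility condition becomes equality of the two mixed derivatives, both denoted \<open>\<gamma>\<close>.\<close>

lemma closed_form_primitive:
  fixes \<alpha> \<beta> \<gamma> :: "real \<Rightarrow> real \<Rightarrow> 'a::euclidean_space"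
  assumes I: "open I" "is_interval I" "x0 \<in> I" and T: "open T" "is_interval T" "t0 \<in> T"
    and \<alpha>: "continuous_on (I \<times> T) (\<lambda>(x, t). \<alpha> x t)"
    and \<beta>: "continuous_on (I \<times> T) (\<lambda>(x, t). \<beta> x t)"
    and \<gamma>: "continuous_on (I \<times> T) (\<lambda>(x, t). \<gamma> x t)"
    and \<alpha>t: "\<And>x t. x \<in> I \<Longrightarrow> t \<in> T \<Longrightarrow> ((\<lambda>s. \<alpha> x s) has_vector_derivative \<gamma> x t) (at t)"
    and \<beta>x: "\<And>x t. x \<in> I \<Longrightarrow> t \<in> T \<Longrightarrow> ((\<lambda>s. \<beta> s t) has_vector_derivative \<gamma> x t) (at x)"
  obtains S where "S x0 t0 = S0"
    and "\<And>x t. x \<in> I \<Longrightarrow> t \<in> T \<Longrightarrow> ((\<lambda>s. S s t) has_vector_derivative \<alpha> x t) (at x)"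
    and "\<And>x t. x \<in> I \<Longrightarrow> t \<in> T \<Longrightarrow> ((\<lambda>s. S x s) has_vector_derivative \<beta> x t) (at t)"
proof -
  have cont: "continuous_on (I \<times> T) (\<lambda>(x, t). forcing (f x t))"
    if "continuous_on (I \<times> T) (\<lambda>(x, t). f x t)" for f :: "real \<Rightarrow> real \<Rightarrow> 'a"
    using bounded_linear.continuous_on [OF bounded_linear_forcing that] by (simp add: split_beta)
  have nilpotent: "forcing a o\<^sub>L forcing b = 0" for a b :: 'a
    by (rule blinfun_eqI) (simp add: forcing_apply zero_prod_def)
  obtain y where y0: "y x0 t0 = (S0, 1)"
    and yx: "\<And>x t. x \<in> I \<Longrightarrow> t \<in> T \<Longrightarrow> ((\<lambda>s. y s t) has_vector_derivative forcing (\<alpha> x t) (y x t)) (at x)"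
    and yt: "\<And>x t. x \<in> I \<Longrightarrow> t \<in> T \<Longrightarrow> ((\<lambda>s. y x s) has_vector_derivative forcing (\<beta> x t) (y x t)) (at t)"
  proof (rule frobenius_linear [OF I T, where ?y0.0 = "(S0, 1)" and L = "\<lambda>x t. forcing (\<alpha> x t)"
        and M = "\<lambda>x t. forcing (\<beta> x t)" and M' = "\<lambda>x t. forcing (\<gamma> x t)"])
    show "continuous_on (I \<times> T) (\<lambda>(x, t). forcing (\<alpha> x t))" by (rule cont [OF \<alpha>])
    show "continuous_on (I \<times> T) (\<lambda>(x, t). forcing (\<beta> x t))" by (rule cont [OF \<beta>])
    show "continuous_on (I \<times> T) (\<lambda>(x, t). forcing (\<gamma> x t))" by (rule cont [OF \<gamma>])
    fix x t assume "x \<in> I" "t \<in> T"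
    then show "((\<lambda>s. forcing (\<beta> s t)) has_vector_derivative forcing (\<gamma> x t)) (at x)"
      "((\<lambda>s. forcing (\<alpha> x s)) has_vector_derivative forcing (\<gamma> x t)
          - (forcing (\<alpha> x t) o\<^sub>L forcing (\<beta> x t)) + (forcing (\<beta> x t) o\<^sub>L forcing (\<alpha> x t))) (at t)"
      by (simp_all add: nilpotent bounded_linear.has_vector_derivative [OF bounded_linear_forcing] \<alpha>t \<beta>x)
  qed blast
  \<comment> \<open>the adjoined coordinate keeps its initial value\<close>
  have one: "snd (y x t) = 1" if "x \<in> I" "t \<in> T" for x t
  proof -
    have "snd (y x t) = snd (y x0 t0)"
    proof (rule zero_partials_constant [OF I(2,3) that(1) T(2,3) that(2)])
      fix x t assume xt: "x \<in> I" "t \<in> T"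
      show "((\<lambda>s. snd (y s t)) has_vector_derivative 0) (at x)"
        "((\<lambda>s. snd (y x s)) has_vector_derivative 0) (at t)"
        using bounded_linear.has_vector_derivative [OF bounded_linear_snd yx [OF xt]]
          bounded_linear.has_vector_derivative [OF bounded_linear_snd yt [OF xt]]
        by (simp_all add: forcing_apply)
    qed
    then show ?thesis by (simp add: y0)
  qed
  show thesis
  proof (rule that [of "\<lambda>x t. fst (y x t)"])
    show "fst (y x0 t0) = S0" by (simp add: y0)
    fix x t assume xt: "x \<in> I" "t \<in> T"
    show "((\<lambda>s. fst (y s t)) has_vector_derivative \<alpha> x t) (at x)"
      "((\<lambda>s. fst (y x s)) has_vector_derivative \<beta> x t) (at t)"
      using bounded_linear.has_vector_derivative [OF bounded_linear_fst yx [OF xt]]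
        bounded_linear.has_vector_derivative [OF bounded_linear_fst yt [OF xt]]
      by (simp_all add: forcing_apply one [OF xt])
  qed
qed

definition sandwich :: "complex^'m^'m \<Rightarrow> complex^'k^'k \<Rightarrow> (complex^'k^'m) \<Rightarrow>\<^sub>L (complex^'k^'m)" where
  "sandwich X Y = Blinfun (\<lambda>M. X ** M ** Y)"

lemma sandwich_apply: "blinfun_apply (sandwich X Y) M = X ** M ** Y"
proof -
  have "bounded_linear (\<lambda>M. X ** M ** Y)"
    by (intro bounded_linear_compose [OF
          bounded_bilinear.bounded_linear_left [OF bounded_bilinear_matrix_mult]
          bounded_bilinear.bounded_linear_right [OF bounded_bilinear_matrix_mult]])
  then show ?thesis by (simp add: sandwich_def bounded_linear_Blinfun_apply)
qed

lemma bounded_linear_sandwich_right: "bounded_linear (sandwich X)"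
  unfolding linear_conv_bounded_linear [symmetric]
  by (auto intro!: linearI blinfun_eqI
      simp: sandwich_apply blinfun.bilinear_simps matrix_add_ldistrib matrix_mult_scaleR)

lemma bounded_linear_sandwich_left: "bounded_linear (\<lambda>X. sandwich X Y)"
  unfolding linear_conv_bounded_linear [symmetric]
  by (auto intro!: linearI blinfun_eqI
      simp: sandwich_apply blinfun.bilinear_simps matrix_algebra_simps matrix_mult_scaleR)

lemma has_vector_derivative_cmod_square:
  assumes "(f has_vector_derivative f') (at t)"
  shows "((\<lambda>s. (cmod (f s))\<^sup>2) has_vector_derivative 2 * Re (cnj (f t) * f')) (at t)"
  using bounded_bilinear.has_vector_derivative [OF bounded_bilinear_inner assms assms]
  by (simp add: power2_norm_eq_inner inner_complex_def algebra_simps)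

locale ccd_seed = ccd_sign +
  fixes I T :: "real set" and \<rho> v :: "real \<Rightarrow> real \<Rightarrow> complex"
  assumes I: "open I" "is_interval I" "0 \<in> I" and T: "open T" "is_interval T" "0 \<in> T"
    and ccd: "ccd_solution \<kappa> (I \<times> T) \<rho> v"
    and cont_vt: "continuous_on (I \<times> T) (\<lambda>(x, t). dt v x t)"
    and cont_v: "continuous_on (I \<times> T) (\<lambda>(x, t). v x t)"
    and cont_\<rho>: "continuous_on (I \<times> T) (\<lambda>(x, t). \<rho> x t)"
begin

abbreviation q where "q x t \<equiv> q_potential p (v x t)"
abbreviation Q where "Q x t \<equiv> Q_potential p (\<rho> x t) (dt v x t)"

context
  fixes x t assumes x: "x \<in> I" and t: "t \<in> T"
begin

lemma \<rho>_real: "cnj (\<rho> x t) = \<rho> x t"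
  using ccd x t unfolding ccd_solution_def by fastforce

lemma v_t: "((\<lambda>s. v x s) has_vector_derivative dt v x t) (at t)"
  using ccd x t unfolding ccd_solution_def dt_def by (auto simp: vector_derivative_works)

lemma v_tx: "((\<lambda>s. dt v s t) has_vector_derivative \<rho> x t * v x t) (at x)"
  using ccd x t unfolding ccd_solution_def dx_def by (force simp: vector_derivative_works)

lemma \<rho>_x: "((\<lambda>s. \<rho> s t) has_vector_derivative of_real (- \<kappa> * Re (cnj (v x t) * dt v x t))) (at x)"
proof -
  have "dt (\<lambda>x t. (cmod (v x t))\<^sup>2) x t = 2 * Re (cnj (v x t) * dt v x t)"
    unfolding dt_def [of "\<lambda>x t. (cmod (v x t))\<^sup>2"]
    by (rule vector_derivative_at [OF has_vector_derivative_cmod_square [OF v_t]])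
  then have *: "\<kappa> / 2 * dt (\<lambda>x t. (cmod (v x t))\<^sup>2) x t = \<kappa> * Re (cnj (v x t) * dt v x t)"
    by simp
  have "((\<lambda>s. \<rho> s t) has_vector_derivative dx \<rho> x t) (at x)"
    "dx \<rho> x t = - of_real (\<kappa> / 2 * dt (\<lambda>x t. (cmod (v x t))\<^sup>2) x t)"
    using ccd x t unfolding ccd_solution_def dx_def
    by (auto simp: vector_derivative_works eq_neg_iff_add_eq_0)
  then show ?thesis by (simp only: * of_real_minus mult_minus_left)
qed

lemma q_t: "((\<lambda>s. q x s) has_vector_derivative q1 ** Q x t - Q x t ** q1) (at t)"
  using bounded_linear.has_vector_derivative [OF linear_q_potential v_t]
  by (simp add: q_potential_commutator [symmetric])

lemma Q_x: "((\<lambda>s. Q s t) has_vector_derivative Q x t ** q x t - q x t ** Q x t) (at x)"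
  using bounded_linear.has_vector_derivative [OF linear_Q_potential has_vector_derivative_Pair [OF \<rho>_x v_tx]]
  by (simp add: Q_potential_commutator [OF \<rho>_real])

end

lemma continuous_q: "continuous_on (I \<times> T) (\<lambda>(x, t). q x t)"
  using bounded_linear.continuous_on [OF linear_q_potential cont_v] by (simp add: split_beta)

lemma continuous_Q: "continuous_on (I \<times> T) (\<lambda>(x, t). Q x t)"
  using bounded_linear.continuous_on [OF linear_Q_potential continuous_on_Pair [OF cont_\<rho> cont_vt]]
  by (simp add: split_beta)

text \<open>Moving \<open>J\<close> to the right of conjugate transposes, as a terminating set of rewrite rules for
  left-nested products.\<close>

lemma J_push_right:
  fixes N :: "complex^2^'m"
  shows "N ** J ** q1 = N ** q1 ** J"
    and "N ** J ** (q_potential p z)\<^sup>H = - (N ** q_potential p z ** J)"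
    and "cnj r = r \<Longrightarrow> N ** J ** (Q_potential p r u)\<^sup>H = - (N ** Q_potential p r u ** J)"
  using J_q1 J_q_potential [of z] J_Q_potential [of r u]
  by (simp_all add: matrix_mult_add_diff_minus flip: matrix_mul_assoc)

lemma Pi_system_solvable:
  fixes A :: "complex^'n^'n" and P0 :: "complex^2^'n"
  assumes A: "invertible A"
  obtains P where "P 0 0 = P0" and "continuous_on (I \<times> T) (\<lambda>(x, t). P x t)"
    and "\<And>x t. x \<in> I \<Longrightarrow> t \<in> T \<Longrightarrow>
      ((\<lambda>s. P s t) has_vector_derivative A ** P x t ** q1 + P x t ** q x t) (at x)"
    and "\<And>x t. x \<in> I \<Longrightarrow> t \<in> T \<Longrightarrow>
      ((\<lambda>s. P x s) has_vector_derivative matrix_inv A ** P x t ** Q x t) (at t)"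
proof -
  define L :: "real \<Rightarrow> real \<Rightarrow> (complex^2^'n) \<Rightarrow>\<^sub>L (complex^2^'n)"
    where "L x t = sandwich A q1 + sandwich (mat 1) (q x t)" for x t
  define M :: "real \<Rightarrow> real \<Rightarrow> (complex^2^'n) \<Rightarrow>\<^sub>L (complex^2^'n)"
    where "M x t = sandwich (matrix_inv A) (Q x t)" for x t
  define M' :: "real \<Rightarrow> real \<Rightarrow> (complex^2^'n) \<Rightarrow>\<^sub>L (complex^2^'n)"
    where "M' x t = sandwich (matrix_inv A) (Q x t ** q x t - q x t ** Q x t)" for x t
  obtain P where P: "P 0 0 = P0" "continuous_on (I \<times> T) (\<lambda>(x, t). P x t)"
    "\<And>x t. x \<in> I \<Longrightarrow> t \<in> T \<Longrightarrow> ((\<lambda>s. P s t) has_vector_derivative L x t (P x t)) (at x)"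
    "\<And>x t. x \<in> I \<Longrightarrow> t \<in> T \<Longrightarrow> ((\<lambda>s. P x s) has_vector_derivative M x t (P x t)) (at t)"
  proof (rule frobenius_linear [OF I T, where L = L and M = M and M' = M' and ?y0.0 = P0])
    show "continuous_on (I \<times> T) (\<lambda>(x, t). L x t)"
      using bounded_linear.continuous_on [OF bounded_linear_sandwich_right continuous_q]
      by (auto simp: L_def split_beta intro!: continuous_intros)
    show "continuous_on (I \<times> T) (\<lambda>(x, t). M x t)"
      using bounded_linear.continuous_on [OF bounded_linear_sandwich_right continuous_Q]
      by (simp add: M_def split_beta)
    have "continuous_on (I \<times> T) (\<lambda>z. (case z of (x, t) \<Rightarrow> Q x t) ** (case z of (x, t) \<Rightarrow> q x t)
        - (case z of (x, t) \<Rightarrow> q x t) ** (case z of (x, t) \<Rightarrow> Q x t))"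
      by (intro continuous_on_diff continuous_on_matrix_mult continuous_q continuous_Q)
    then show "continuous_on (I \<times> T) (\<lambda>(x, t). M' x t)"
      using bounded_linear.continuous_on [OF bounded_linear_sandwich_right]
      by (fastforce simp: M'_def split_beta)
    fix x t assume xt: "x \<in> I" "t \<in> T"
    show "((\<lambda>s. M s t) has_vector_derivative M' x t) (at x)"
      unfolding M_def M'_def
      by (rule bounded_linear.has_vector_derivative [OF bounded_linear_sandwich_right Q_x [OF xt]])
    have "((\<lambda>s. L x s) has_vector_derivative 0 + sandwich (mat 1) (q1 ** Q x t - Q x t ** q1)) (at t)"
      unfolding L_def
      by (intro has_vector_derivative_add has_vector_derivative_const
          bounded_linear.has_vector_derivative [OF bounded_linear_sandwich_right q_t [OF xt]])
    moreover have "M' x t - (L x t o\<^sub>L M x t) + (M x t o\<^sub>L L x t)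
        = sandwich (mat 1) (q1 ** Q x t - Q x t ** q1)"
      using A by (intro blinfun_eqI)
        (simp add: L_def M_def M'_def sandwich_apply blinfun.bilinear_simps matrix_algebra_simps
          matrix_inv_cancel matrix_inv_cancel_middle)
    ultimately show "((\<lambda>s. L x s) has_vector_derivative
        M' x t - (L x t o\<^sub>L M x t) + (M x t o\<^sub>L L x t)) (at t)"
      by simp
  qed blast
  show thesis
    by (rule that [OF P(1,2)])
       (use P(3,4) in \<open>simp_all add: L_def M_def sandwich_apply blinfun.bilinear_simps\<close>)
qed

lemma wave_system_solvable:
  fixes W0 :: "complex^2^2"
  assumes lam: "lam \<noteq> 0"
  obtains w where "w 0 0 = W0"
    and "\<And>x t. x \<in> I \<Longrightarrow> t \<in> T \<Longrightarrow> ((\<lambda>s. w s t) has_vector_derivative Gmat p lam v x t ** w x t) (at x)"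
    and "\<And>x t. x \<in> I \<Longrightarrow> t \<in> T \<Longrightarrow> ((\<lambda>s. w x s) has_vector_derivative Fmat p lam \<rho> v x t ** w x t) (at t)"
proof -
  define L :: "real \<Rightarrow> real \<Rightarrow> (complex^2^2) \<Rightarrow>\<^sub>L (complex^2^2)"
    where "L x t = sandwich (- (lam *\<^sub>m q1 + q x t)) (mat 1)" for x t
  define M :: "real \<Rightarrow> real \<Rightarrow> (complex^2^2) \<Rightarrow>\<^sub>L (complex^2^2)"
    where "M x t = sandwich (- ((1 / lam) *\<^sub>m Q x t)) (mat 1)" for x t
  define M' :: "real \<Rightarrow> real \<Rightarrow> (complex^2^2) \<Rightarrow>\<^sub>L (complex^2^2)"
    where "M' x t = sandwich (- ((1 / lam) *\<^sub>m (Q x t ** q x t - q x t ** Q x t))) (mat 1)" for x t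
  obtain w where w: "w 0 0 = W0"
    "\<And>x t. x \<in> I \<Longrightarrow> t \<in> T \<Longrightarrow> ((\<lambda>s. w s t) has_vector_derivative L x t (w x t)) (at x)"
    "\<And>x t. x \<in> I \<Longrightarrow> t \<in> T \<Longrightarrow> ((\<lambda>s. w x s) has_vector_derivative M x t (w x t)) (at t)"
  proof (rule frobenius_linear [OF I T, where L = L and M = M and M' = M' and ?y0.0 = W0])
    have "continuous_on (I \<times> T) (\<lambda>z. - (lam *\<^sub>m q1 + (case z of (x, t) \<Rightarrow> q x t)))"
      by (intro continuous_on_minus continuous_on_add continuous_on_const continuous_q)
    then show "continuous_on (I \<times> T) (\<lambda>(x, t). L x t)"
      using bounded_linear.continuous_on [OF bounded_linear_sandwich_left]
      by (fastforce simp: L_def split_beta)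
    have "continuous_on (I \<times> T) (\<lambda>z. - ((1 / lam) *\<^sub>m (case z of (x, t) \<Rightarrow> Q x t)))"
      by (intro continuous_on_minus continuous_on_cscale continuous_Q)
    then show "continuous_on (I \<times> T) (\<lambda>(x, t). M x t)"
      using bounded_linear.continuous_on [OF bounded_linear_sandwich_left]
      by (fastforce simp: M_def split_beta)
    have "continuous_on (I \<times> T) (\<lambda>z. - ((1 / lam) *\<^sub>m
        ((case z of (x, t) \<Rightarrow> Q x t) ** (case z of (x, t) \<Rightarrow> q x t)
        - (case z of (x, t) \<Rightarrow> q x t) ** (case z of (x, t) \<Rightarrow> Q x t))))"
      by (intro continuous_on_minus continuous_on_cscale continuous_on_diff continuous_on_matrix_mult
          continuous_q continuous_Q)
    then show "continuous_on (I \<times> T) (\<lambda>(x, t). M' x t)"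
      using bounded_linear.continuous_on [OF bounded_linear_sandwich_left]
      by (fastforce simp: M'_def split_beta)
    fix x t assume xt: "x \<in> I" "t \<in> T"
    show "((\<lambda>s. M s t) has_vector_derivative M' x t) (at x)"
      unfolding M_def M'_def
      by (intro bounded_linear.has_vector_derivative [OF bounded_linear_sandwich_left]
          has_vector_derivative_minus has_vector_derivative_cscale Q_x [OF xt])
    have "((\<lambda>s. L x s) has_vector_derivative
        sandwich (- (0 + (q1 ** Q x t - Q x t ** q1))) (mat 1)) (at t)"
      unfolding L_def
      by (intro bounded_linear.has_vector_derivative [OF bounded_linear_sandwich_left]
          has_vector_derivative_minus has_vector_derivative_add has_vector_derivative_const q_t [OF xt])
    moreover have "M' x t - (L x t o\<^sub>L M x t) + (M x t o\<^sub>L L x t)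
        = sandwich (- (0 + (q1 ** Q x t - Q x t ** q1))) (mat 1)"
      using lam by (intro blinfun_eqI)
        (simp add: L_def M_def M'_def sandwich_apply blinfun.bilinear_simps matrix_algebra_simps
          algebra_simps)
    ultimately show "((\<lambda>s. L x s) has_vector_derivative
        M' x t - (L x t o\<^sub>L M x t) + (M x t o\<^sub>L L x t)) (at t)"
      by simp
  qed blast
  show thesis
    by (rule that [of w, OF w(1)])
       (use w(2,3) in \<open>simp_all only: L_def M_def sandwich_apply coefficient_matrices matrix_mul_rid\<close>)
qed

text \<open>Both mixed derivatives reduce to \<open>\<gamma>\<close> by \<open>J Q\<^sup>H = - Q J\<close>, \<open>J q\<^sub>0\<^sup>H = - q\<^sub>0 J\<close> and the
  zero curvature relations.\<close>

lemma S_system_solvable: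
  fixes A :: "complex^'n^'n" and S0 :: "complex^'n^'n"
  assumes A: "invertible A" and contP: "continuous_on (I \<times> T) (\<lambda>(x, t). P x t)"
    and Px: "\<And>x t. x \<in> I \<Longrightarrow> t \<in> T \<Longrightarrow>
      ((\<lambda>s. P s t) has_vector_derivative A ** P x t ** q1 + P x t ** q x t) (at x)"
    and Pt: "\<And>x t. x \<in> I \<Longrightarrow> t \<in> T \<Longrightarrow>
      ((\<lambda>s. P x s) has_vector_derivative matrix_inv A ** P x t ** Q x t) (at t)"
  obtains S where "S 0 0 = S0"
    and "\<And>x t. x \<in> I \<Longrightarrow> t \<in> T \<Longrightarrow> ((\<lambda>s. S s t) has_vector_derivative
      \<i> *\<^sub>m (P x t ** q1 ** J ** (P x t)\<^sup>H)) (at x)"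
    and "\<And>x t. x \<in> I \<Longrightarrow> t \<in> T \<Longrightarrow> ((\<lambda>s. S x s) has_vector_derivative
      (- \<i>) *\<^sub>m (matrix_inv A ** P x t ** Q x t ** J ** (P x t)\<^sup>H ** matrix_inv (A\<^sup>H))) (at t)"
proof (rule closed_form_primitive [OF I T, where ?S0.0 = S0
      and \<alpha> = "\<lambda>x t. \<i> *\<^sub>m (P x t ** q1 ** J ** (P x t)\<^sup>H)"
      and \<beta> = "\<lambda>x t. (- \<i>) *\<^sub>m (matrix_inv A ** P x t ** Q x t ** J ** (P x t)\<^sup>H ** matrix_inv (A\<^sup>H))"
      and \<gamma> = "\<lambda>x t. \<i> *\<^sub>m (matrix_inv A ** P x t ** Q x t ** q1 ** J ** (P x t)\<^sup>H)
        - \<i> *\<^sub>m (P x t ** q1 ** Q x t ** J ** (P x t)\<^sup>H ** matrix_inv (A\<^sup>H))"])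
  let ?P = "\<lambda>z. case z of (x, t) \<Rightarrow> P x t" and ?Q = "\<lambda>z. case z of (x, t) \<Rightarrow> Q x t"
  note cont = continuous_on_diff continuous_on_cscale continuous_on_matrix_mult
    continuous_on_conj_transpose continuous_on_const contP continuous_Q
  have "continuous_on (I \<times> T) (\<lambda>z. \<i> *\<^sub>m (?P z ** q1 ** J ** (?P z)\<^sup>H))"
    by (intro cont)
  then show "continuous_on (I \<times> T) (\<lambda>(x, t). \<i> *\<^sub>m (P x t ** q1 ** J ** (P x t)\<^sup>H))"
    by (simp add: split_beta)
  have "continuous_on (I \<times> T) (\<lambda>z. (- \<i>) *\<^sub>m (matrix_inv A ** ?P z ** ?Q z ** J ** (?P z)\<^sup>H ** matrix_inv (A\<^sup>H)))"
    by (intro cont)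
  then show "continuous_on (I \<times> T) (\<lambda>(x, t).
      (- \<i>) *\<^sub>m (matrix_inv A ** P x t ** Q x t ** J ** (P x t)\<^sup>H ** matrix_inv (A\<^sup>H)))"
    by (simp add: split_beta)
  have "continuous_on (I \<times> T) (\<lambda>z. \<i> *\<^sub>m (matrix_inv A ** ?P z ** ?Q z ** q1 ** J ** (?P z)\<^sup>H)
        - \<i> *\<^sub>m (?P z ** q1 ** ?Q z ** J ** (?P z)\<^sup>H ** matrix_inv (A\<^sup>H)))"
    by (intro cont)
  then show "continuous_on (I \<times> T) (\<lambda>(x, t).
      \<i> *\<^sub>m (matrix_inv A ** P x t ** Q x t ** q1 ** J ** (P x t)\<^sup>H)
        - \<i> *\<^sub>m (P x t ** q1 ** Q x t ** J ** (P x t)\<^sup>H ** matrix_inv (A\<^sup>H)))"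
    by (simp add: split_beta)
  fix x t assume xt: "x \<in> I" "t \<in> T"
  note simps = matrix_algebra_simps conj_transpose_simps conj_transpose_matrix_inv [OF A]
    q1_conj_transpose J_push_right J_push_right(3) [OF \<rho>_real [OF xt]]
    matrix_inv_cancel [OF A] matrix_inv_cancel_middle [OF A]
    matrix_inv_cancel_middle [OF conj_transpose_matrix_inv(2) [OF A]]
  show "((\<lambda>s. \<i> *\<^sub>m (P x s ** q1 ** J ** (P x s)\<^sup>H)) has_vector_derivative
      \<i> *\<^sub>m (matrix_inv A ** P x t ** Q x t ** q1 ** J ** (P x t)\<^sup>H)
        - \<i> *\<^sub>m (P x t ** q1 ** Q x t ** J ** (P x t)\<^sup>H ** matrix_inv (A\<^sup>H))) (at t)"
    by (rule has_vector_derivative_eq_rhs,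
        (rule has_vector_derivative_const has_vector_derivative_cscale has_vector_derivative_matrix_mult
          has_vector_derivative_conj_transpose Pt [OF xt])+)
      (simp add: simps algebra_simps)
  show "((\<lambda>s. (- \<i>) *\<^sub>m (matrix_inv A ** P s t ** Q s t ** J ** (P s t)\<^sup>H ** matrix_inv (A\<^sup>H)))
      has_vector_derivative
      \<i> *\<^sub>m (matrix_inv A ** P x t ** Q x t ** q1 ** J ** (P x t)\<^sup>H)
        - \<i> *\<^sub>m (P x t ** q1 ** Q x t ** J ** (P x t)\<^sup>H ** matrix_inv (A\<^sup>H))) (at x)"
    by (rule has_vector_derivative_eq_rhs,
        (rule has_vector_derivative_const has_vector_derivative_cscale has_vector_derivative_matrix_mult
          has_vector_derivative_conj_transpose Px [OF xt] Q_x [OF xt])+)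
      (simp add: simps algebra_simps)
qed (use that in blast)

end

section \<open>Uniqueness\<close>

lemma matrix_pde_unique_on_box:
  fixes w w' :: "real \<Rightarrow> real \<Rightarrow> complex^2^2"
  assumes I: "is_interval I" "x0 \<in> I" "x \<in> I" and T: "is_interval T" "t0 \<in> T" "t \<in> T"
    and G: "continuous_on I (\<lambda>x. G x t0)" and F: "continuous_on T (\<lambda>t. F x t)"
    and wx: "\<And>x. x \<in> I \<Longrightarrow> ((\<lambda>s. w s t0) has_vector_derivative G x t0 ** w x t0) (at x)"
    and wt: "\<And>t. t \<in> T \<Longrightarrow> ((\<lambda>s. w x s) has_vector_derivative F x t ** w x t) (at t)"
    and w'x: "\<And>x. x \<in> I \<Longrightarrow> ((\<lambda>s. w' s t0) has_vector_derivative G x t0 ** w' x t0) (at x)"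
    and w't: "\<And>t. t \<in> T \<Longrightarrow> ((\<lambda>s. w' x s) has_vector_derivative F x t ** w' x t) (at t)"
    and init: "w x0 t0 = w' x0 t0"
  shows "w x t = w' x t"
proof (rule linear_pde_unique_on_box [where L = "\<lambda>x t. sandwich (G x t) (mat 1)"
      and M = "\<lambda>x t. sandwich (F x t) (mat 1)", OF I T])
  show "continuous_on I (\<lambda>x. sandwich (G x t0) (mat 1))"
    "continuous_on T (\<lambda>t. sandwich (F x t) (mat 1))"
    by (rule bounded_linear.continuous_on [OF bounded_linear_sandwich_left]; fact G F)+
qed (simp_all add: sandwich_apply wx wt w'x w't init)

text \<open>By uniqueness on small boxes, two solutions that agree at one point of a box agree
  throughout the box; connectedness carries agreement from one point to all of \<open>U\<close>.\<close>

lemma matrix_pde_unique_on_connected: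
  fixes w w' :: "real \<Rightarrow> real \<Rightarrow> complex^2^2"
  assumes U: "open U" "connected U" "(x0, t0) \<in> U" "(x, t) \<in> U"
    and G: "\<And>x t. (x, t) \<in> U \<Longrightarrow> isCont (\<lambda>s. G s t) x"
    and F: "\<And>x t. (x, t) \<in> U \<Longrightarrow> isCont (\<lambda>s. F x s) t"
    and wx: "\<And>x t. (x, t) \<in> U \<Longrightarrow> ((\<lambda>s. w s t) has_vector_derivative G x t ** w x t) (at x)"
    and wt: "\<And>x t. (x, t) \<in> U \<Longrightarrow> ((\<lambda>s. w x s) has_vector_derivative F x t ** w x t) (at t)"
    and w'x: "\<And>x t. (x, t) \<in> U \<Longrightarrow> ((\<lambda>s. w' s t) has_vector_derivative G x t ** w' x t) (at x)"
    and w't: "\<And>x t. (x, t) \<in> U \<Longrightarrow> ((\<lambda>s. w' x s) has_vector_derivative F x t ** w' x t) (at t)"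
    and init: "w x0 t0 = w' x0 t0"
  shows "w x t = w' x t"
proof -
  define P where "P z \<longleftrightarrow> (case z of (x, t) \<Rightarrow> w x t = w' x t)" for z
  have "P (x, t)"
  proof (rule connected_induction_simple [OF U(2) U(3,4)])
    show "P (x0, t0)" by (simp add: P_def init)
    fix z assume z: "z \<in> U"
    obtain a b where ab: "z = (a, b)" by force
    obtain A B where AB: "open A" "open B" "z \<in> A \<times> B" "A \<times> B \<subseteq> U"
      using open_prod_elim [OF U(1) z] by metis
    obtain d where d: "d > 0" "ball a d \<subseteq> A"
      using AB ab open_contains_ball [of A] by auto
    obtain e where e: "e > 0" "ball b e \<subseteq> B"
      using AB ab open_contains_ball [of B] by auto
    have sub: "ball a d \<times> ball b e \<subseteq> U" using d e AB by blast
    have interval: "is_interval (ball a d)" "is_interval (ball b e)"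
      by (simp_all add: is_interval_convex_1)
    have "w x t = w' x t" if xt: "x \<in> ball a d" "t \<in> ball b e"
      and eq: "w x1 t1 = w' x1 t1" and xt1: "x1 \<in> ball a d" "t1 \<in> ball b e" for x t x1 t1
    proof (rule matrix_pde_unique_on_box [where G = G and F = F and w = w and w' = w',
          OF interval(1) xt1(1) xt(1) interval(2) xt1(2) xt(2) _ _ _ _ _ _ eq])
      show "continuous_on (ball a d) (\<lambda>x. G x t1)"
        using G sub xt1 by (blast intro: continuous_at_imp_continuous_on)
      show "continuous_on (ball b e) (\<lambda>t. F x t)"
        using F sub xt by (blast intro: continuous_at_imp_continuous_on)
    qed (use sub xt xt1 in \<open>blast intro: wx wt w'x w't\<close>)+
    then have "\<forall>y\<in>ball a d \<times> ball b e. \<forall>z\<in>ball a d \<times> ball b e. P y \<longrightarrow> P z"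
      unfolding P_def by blast
    moreover have "openin (top_of_set U) (ball a d \<times> ball b e)"
      by (rule open_openin_trans [OF U(1) open_Times sub]) auto
    moreover have "z \<in> ball a d \<times> ball b e" using d e ab by simp
    ultimately show "\<exists>T. openin (top_of_set U) T \<and> z \<in> T \<and> (\<forall>x\<in>T. \<forall>y\<in>T. P x \<longrightarrow> P y)"
      by blast
  qed
  then show ?thesis by (simp add: P_def)
qed

context ccd_seed
begin

lemma linear_systems_iff:
  fixes A :: "complex^'n^'n"
  shows "linear_systems p (I \<times> T) \<rho> v A P S \<longleftrightarrow> (\<forall>x\<in>I. \<forall>t\<in>T.
    ((\<lambda>s. P s t) has_vector_derivative A ** P x t ** q1 + P x t ** q x t) (at x) \<and>
    ((\<lambda>s. P x s) has_vector_derivative matrix_inv A ** P x t ** Q x t) (at t) \<and>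
    ((\<lambda>s. S s t) has_vector_derivative \<i> *\<^sub>m (P x t ** q1 ** J ** (P x t)\<^sup>H)) (at x) \<and>
    ((\<lambda>s. S x s) has_vector_derivative
      (- \<i>) *\<^sub>m (matrix_inv A ** P x t ** Q x t ** J ** (P x t)\<^sup>H ** matrix_inv (A\<^sup>H))) (at t))"
  unfolding linear_systems_def coefficient_matrices Suc_eq_plus1 by auto

lemma linear_systems_solvable:
  fixes A S0 :: "complex^'n^'n"
  assumes A: "invertible A"
  obtains P S where "linear_systems p (I \<times> T) \<rho> v A P S" and "P 0 0 = P0" and "S 0 0 = S0"
proof -
  obtain P where P: "P 0 0 = P0" and cont: "continuous_on (I \<times> T) (\<lambda>(x, t). P x t)"
    and Px: "\<And>x t. x \<in> I \<Longrightarrow> t \<in> T \<Longrightarrow>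
      ((\<lambda>s. P s t) has_vector_derivative A ** P x t ** q1 + P x t ** q x t) (at x)"
    and Pt: "\<And>x t. x \<in> I \<Longrightarrow> t \<in> T \<Longrightarrow>
      ((\<lambda>s. P x s) has_vector_derivative matrix_inv A ** P x t ** Q x t) (at t)"
    using Pi_system_solvable [OF A, of P0] by blast
  obtain S where S: "S 0 0 = S0"
    and Sx: "\<And>x t. x \<in> I \<Longrightarrow> t \<in> T \<Longrightarrow> ((\<lambda>s. S s t) has_vector_derivative
      \<i> *\<^sub>m (P x t ** q1 ** J ** (P x t)\<^sup>H)) (at x)"
    and St: "\<And>x t. x \<in> I \<Longrightarrow> t \<in> T \<Longrightarrow> ((\<lambda>s. S x s) has_vector_derivative
      (- \<i>) *\<^sub>m (matrix_inv A ** P x t ** Q x t ** J ** (P x t)\<^sup>H ** matrix_inv (A\<^sup>H))) (at t)"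
    using S_system_solvable [OF A cont Px Pt, of S0] by blast
  show thesis
    by (rule that [of P S]) (use P S Px Pt Sx St in \<open>simp_all add: linear_systems_iff\<close>)
qed

lemma linear_systems_unique:
  fixes A :: "complex^'n^'n"
  assumes 1: "linear_systems p (I \<times> T) \<rho> v A P S" and 2: "linear_systems p (I \<times> T) \<rho> v A P' S'"
    and P: "P' 0 0 = P 0 0" and S: "S' 0 0 = S 0 0" and xt: "x \<in> I" "t \<in> T"
  shows "P' x t = P x t" and "S' x t = S x t"
proof -
  have PP: "P' x t = P x t" if "x \<in> I" "t \<in> T" for x t
  proof (rule linear_pde_unique_on_box [OF I(2,3) that(1) T(2,3) that(2), where
        L = "\<lambda>x t. sandwich A q1 + sandwich (mat 1) (q x t)"
        and M = "\<lambda>x t. sandwich (matrix_inv A) (Q x t)"])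
    show "continuous_on I (\<lambda>x. sandwich A q1 + sandwich (mat 1) (q x 0) :: (complex^2^'n) \<Rightarrow>\<^sub>L (complex^2^'n))"
      by (intro continuous_on_add continuous_on_const T(3)
          bounded_linear.continuous_on [OF bounded_linear_sandwich_right]
          continuous_on_product_sections(1) [OF continuous_q])
    show "continuous_on T (\<lambda>t. sandwich (matrix_inv A) (Q x t) :: (complex^2^'n) \<Rightarrow>\<^sub>L (complex^2^'n))"
      by (intro that(1) bounded_linear.continuous_on [OF bounded_linear_sandwich_right]
          continuous_on_product_sections(2) [OF continuous_Q])
  qed (use 1 2 P that I T in \<open>simp_all add: linear_systems_iff sandwich_apply blinfun.add_left\<close>)
  from PP xt show "P' x t = P x t" by simp
  have "S' x t - S x t = S' 0 0 - S 0 0"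
  proof (rule zero_partials_constant [OF I(2,3) xt(1) T(2,3) xt(2)])
    fix x t assume xt: "x \<in> I" "t \<in> T"
    have eq: "P' x t = P x t" by (rule PP [OF xt])
    have S: "((\<lambda>s. S s t) has_vector_derivative \<i> *\<^sub>m (P x t ** q1 ** J ** (P x t)\<^sup>H)) (at x)"
      "((\<lambda>s. S x s) has_vector_derivative
        (- \<i>) *\<^sub>m (matrix_inv A ** P x t ** Q x t ** J ** (P x t)\<^sup>H ** matrix_inv (A\<^sup>H))) (at t)"
      using 1 xt by (simp_all add: linear_systems_iff)
    have S': "((\<lambda>s. S' s t) has_vector_derivative \<i> *\<^sub>m (P x t ** q1 ** J ** (P x t)\<^sup>H)) (at x)"
      "((\<lambda>s. S' x s) has_vector_derivative
        (- \<i>) *\<^sub>m (matrix_inv A ** P x t ** Q x t ** J ** (P x t)\<^sup>H ** matrix_inv (A\<^sup>H))) (at t)"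
      using 2 xt unfolding eq [symmetric] by (simp_all add: linear_systems_iff)
    show "((\<lambda>s. S' s t - S s t) has_vector_derivative 0) (at x)"
      using has_vector_derivative_diff [OF S'(1) S(1)] by simp
    show "((\<lambda>s. S' x s - S x s) has_vector_derivative 0) (at t)"
      using has_vector_derivative_diff [OF S'(2) S(2)] by simp
  qed
  then show "S' x t = S x t" by (simp add: S)
qed

lemma wave_function_unique:
  assumes "wave_function p lam (I \<times> T) \<rho> v w" and "wave_function p lam (I \<times> T) \<rho> v w'"
    and "w' 0 0 = w 0 0" and xt: "x \<in> I" "t \<in> T"
  shows "w' x t = w x t"
proof (rule matrix_pde_unique_on_box [OF I(2,3) xt(1) T(2,3) xt(2),
      where G = "Gmat p lam v" and F = "Fmat p lam \<rho> v"])
  show "continuous_on I (\<lambda>x. Gmat p lam v x 0)"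
    unfolding coefficient_matrices
    by (intro continuous_on_minus continuous_on_add continuous_on_const T(3)
        continuous_on_product_sections(1) [OF continuous_q])
  show "continuous_on T (\<lambda>t. Fmat p lam \<rho> v x t)"
    unfolding coefficient_matrices
    by (intro continuous_on_minus continuous_on_cscale xt(1)
        continuous_on_product_sections(2) [OF continuous_Q])
qed (use assms I T in \<open>auto simp: wave_function_def\<close>)

lemma wave_function_exists:
  assumes "lam \<noteq> 0" and "det W0 \<noteq> 0"
  obtains w where "wave_function p lam (I \<times> T) \<rho> v w" and "w 0 0 = W0"
proof -
  obtain w where "w 0 0 = W0"
    and "\<And>x t. x \<in> I \<Longrightarrow> t \<in> T \<Longrightarrow> ((\<lambda>s. w s t) has_vector_derivative Gmat p lam v x t ** w x t) (at x)"
    and "\<And>x t. x \<in> I \<Longrightarrow> t \<in> T \<Longrightarrow> ((\<lambda>s. w x s) has_vector_derivative Fmat p lam \<rho> v x t ** w x t) (at t)"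
    using wave_system_solvable [OF assms(1), of W0] by blast
  then show thesis
    by (intro that [of w]) (use assms(2) I(3) T(3) in \<open>auto simp: wave_function_def\<close>)
qed

end

section \<open>The transformed solution\<close>

text \<open>The left-hand side is the derivative of \<open>K Q K'\<close> when \<open>K' = K\<inverse>\<close>,
  \<open>\<partial> K = K q - r K\<close> and \<open>\<partial> Q = [Q, q]\<close>: a gauge transformation preserves the Lax equation.\<close>

lemma conjugation_derivative_identity:
  fixes K K' Q q r :: "complex^2^2"
  assumes "K ** K' = mat 1" and "K' ** K = mat 1"
  shows "K ** Q ** - (K' ** (K ** q - r ** K) ** K')
      + (K ** (Q ** q - q ** Q) + (K ** q - r ** K) ** Q) ** K'
    = K ** Q ** K' ** r - r ** (K ** Q ** K')"
proof -
  have "N ** K ** K' = N" "N ** K' ** K = N" for N :: "complex^2^2"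
    using assms by (simp_all flip: matrix_mul_assoc)
  then show ?thesis by (simp add: matrix_algebra_simps)
qed

locale ccd_darboux = ccd_seed +
  fixes A :: "complex^'n^'n" and P :: "real \<Rightarrow> real \<Rightarrow> complex^2^'n"
    and S :: "real \<Rightarrow> real \<Rightarrow> complex^'n^'n"
  assumes A: "invertible A"
    and systems: "linear_systems p (I \<times> T) \<rho> v A P S"
    and hermitian0: "(S 0 0)\<^sup>H = S 0 0"
    and sylvester0: "A ** S 0 0 - S 0 0 ** A\<^sup>H = \<i> *\<^sub>m (P 0 0 ** J ** (P 0 0)\<^sup>H)"
    and invertible0: "invertible (S 0 0)"
begin

lemma AH: "invertible (A\<^sup>H)"
  by (rule conj_transpose_matrix_inv(2) [OF A])

context
  fixes x t assumes xt: "x \<in> I" "t \<in> T"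
begin

lemma P_x: "((\<lambda>s. P s t) has_vector_derivative A ** P x t ** q1 + P x t ** q x t) (at x)"
  and P_t: "((\<lambda>s. P x s) has_vector_derivative matrix_inv A ** P x t ** Q x t) (at t)"
  and S_x: "((\<lambda>s. S s t) has_vector_derivative \<i> *\<^sub>m (P x t ** q1 ** J ** (P x t)\<^sup>H)) (at x)"
  and S_t: "((\<lambda>s. S x s) has_vector_derivative
      (- \<i>) *\<^sub>m (matrix_inv A ** P x t ** Q x t ** J ** (P x t)\<^sup>H ** matrix_inv (A\<^sup>H))) (at t)"
  using systems xt by (auto simp: linear_systems_iff)

lemmas conj_transpose_reduce = matrix_algebra_simps conj_transpose_simps conj_transpose_matrix_inv(1) [OF A]
    q1_conj_transpose J_conj_transpose J_q1 J_q_potential J_Q_potential [OF \<rho>_real [OF xt]]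
    J_push_right J_push_right(3) [OF \<rho>_real [OF xt]]
    matrix_inv_cancel [OF A] matrix_inv_cancel_middle [OF A]
    matrix_inv_cancel [OF AH] matrix_inv_cancel_middle [OF AH]

end

lemma S_hermitian:
  assumes "x \<in> I" "t \<in> T"
  shows "(S x t)\<^sup>H = S x t"
proof -
  have "(S x t)\<^sup>H - S x t = (S 0 0)\<^sup>H - S 0 0"
  proof (rule zero_partials_constant [OF I(2,3) assms(1) T(2,3) assms(2)])
    fix x t assume xt: "x \<in> I" "t \<in> T"
    have "J ** q1 ** N = q1 ** J ** N" "J ** (Q x t)\<^sup>H ** N = - (Q x t ** J ** N)" for N :: "complex^'n^2"
      by (simp_all add: J_q1 J_Q_potential [OF \<rho>_real [OF xt]] matrix_algebra_simps)
    note reduce = this conj_transpose_reduce [OF xt] conj_transpose_matrix_inv(1) [OF AH]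
    show "((\<lambda>s. (S s t)\<^sup>H - S s t) has_vector_derivative 0) (at x)"
      by (rule has_vector_derivative_eq_rhs [OF has_vector_derivative_diff
            [OF has_vector_derivative_conj_transpose [OF S_x [OF xt]] S_x [OF xt]]])
         (simp add: reduce)
    show "((\<lambda>s. (S x s)\<^sup>H - S x s) has_vector_derivative 0) (at t)"
      by (rule has_vector_derivative_eq_rhs [OF has_vector_derivative_diff
            [OF has_vector_derivative_conj_transpose [OF S_t [OF xt]] S_t [OF xt]]])
         (simp add: reduce)
  qed
  then show ?thesis by (simp add: hermitian0)
qed

lemma sylvester:
  assumes "x \<in> I" "t \<in> T"
  shows "A ** S x t - S x t ** A\<^sup>H = \<i> *\<^sub>m (P x t ** J ** (P x t)\<^sup>H)"
proof -
  define R where "R x t = A ** S x t - S x t ** A\<^sup>H - \<i> *\<^sub>m (P x t ** J ** (P x t)\<^sup>H)" for x t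
  have "R x t = R 0 0"
  proof (rule zero_partials_constant [OF I(2,3) assms(1) T(2,3) assms(2)])
    fix x t assume xt: "x \<in> I" "t \<in> T"
    note deriv = has_vector_derivative_const has_vector_derivative_cscale has_vector_derivative_diff
        has_vector_derivative_matrix_mult has_vector_derivative_conj_transpose
    show "((\<lambda>s. R s t) has_vector_derivative 0) (at x)"
      unfolding R_def
      by (rule has_vector_derivative_eq_rhs, (rule deriv P_x [OF xt] S_x [OF xt])+)
         (simp add: conj_transpose_reduce [OF xt] algebra_simps)
    show "((\<lambda>s. R x s) has_vector_derivative 0) (at t)"
      unfolding R_def
      by (rule has_vector_derivative_eq_rhs, (rule deriv P_t [OF xt] S_t [OF xt])+)
         (simp add: conj_transpose_reduce [OF xt] algebra_simps)
  qed
  then show ?thesis by (simp add: R_def sylvester0)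
qed

definition C where "C x t = J ** (P x t)\<^sup>H"
definition B where "B x t = C x t ** matrix_inv (S x t)"
text \<open>The coefficient of \<open>1 / \<lambda>\<close> in the expansion of the Darboux matrix at infinity, which
  determines the change of the potential \<open>v\<close>.\<close>

definition X0 where "X0 x t = \<i> *\<^sub>m (B x t ** P x t)"

abbreviation v' where "v' \<equiv> v_transformed v P S"
abbreviation \<rho>' where "\<rho>' \<equiv> rho_transformed p \<rho> v A P S"
abbreviation Q' where "Q' \<equiv> Qm1_transformed p \<rho> v A P S"
abbreviation q' where "q' x t \<equiv> q_potential p (v' x t)"
abbreviation X where "X x t \<equiv> Xm1 p A (P x t) (S x t)"
abbreviation Y where "Y x t \<equiv> Ym1 p A (P x t) (S x t)"
abbreviation W where "W lam x t \<equiv> darboux_matrix p A P S lam x t"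

lemma Xm1_eq: "X x t = \<i> *\<^sub>m (B x t ** matrix_inv A ** P x t)"
  by (simp add: Xm1_def B_def C_def)

lemma Ym1_eq: "Y x t = \<i> *\<^sub>m (C x t ** matrix_inv (A\<^sup>H) ** matrix_inv (S x t) ** P x t)"
  by (simp add: Ym1_def C_def)

lemma Q'_eq: "Q' x t = (mat 1 - X x t) ** Q x t ** (mat 1 + Y x t)"
  by (simp add: Qm1_transformed_def coefficient_matrices)

lemma W_eq: "W lam x t = mat 1 - \<i> *\<^sub>m (B x t ** matrix_inv (A - mat lam) ** P x t)"
  by (simp add: darboux_matrix_def B_def C_def)

lemma W_zero: "W 0 x t = mat 1 - X x t"
  by (simp add: W_eq Xm1_eq)

lemma v'_eq: "v' x t = v x t + X0 x t $ 1 $ 2"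
proof -
  have "X0 x t $ 1 $ 2 = \<i> * ((P x t)\<^sup>H ** (matrix_inv (S x t) ** P x t)) $ 1 $ 2"
    by (simp add: X0_def B_def C_def cscale_nth matrix_2x2_mult_nth flip: matrix_mul_assoc)
  also have "((P x t)\<^sup>H ** (matrix_inv (S x t) ** P x t)) $ 1 $ 2
      = (\<Sum>k\<in>UNIV. cnj (column 1 (P x t) $ k) * (matrix_inv (S x t) *v column 2 (P x t)) $ k)"
    by (simp add: matrix_matrix_mult_def matrix_vector_mult_def column_def conj_transpose_nth)
  finally show ?thesis by (simp add: v_transformed_def)
qed

context
  fixes x t assumes xt: "x \<in> I" "t \<in> T" and S: "invertible (S x t)"
begin

lemma sylvester': "A ** S x t - S x t ** A\<^sup>H = \<i> *\<^sub>m (P x t ** C x t)"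
  using sylvester [OF xt] by (simp add: C_def matrix_mul_assoc)

lemma inv_S_hermitian: "(matrix_inv (S x t))\<^sup>H = matrix_inv (S x t)"
  by (simp add: conj_transpose_matrix_inv(1) [OF S] S_hermitian [OF xt])

lemma C_x: "((\<lambda>s. C s t) has_vector_derivative - (q1 ** C x t ** A\<^sup>H) - q x t ** C x t) (at x)"
  unfolding C_def
  by (rule has_vector_derivative_eq_rhs, (rule has_vector_derivative_const
      has_vector_derivative_matrix_mult has_vector_derivative_conj_transpose P_x [OF xt])+)
    (simp add: conj_transpose_reduce [OF xt])

lemma C_t: "((\<lambda>s. C x s) has_vector_derivative - (Q x t ** C x t ** matrix_inv (A\<^sup>H))) (at t)"
  unfolding C_def
  by (rule has_vector_derivative_eq_rhs, (rule has_vector_derivative_const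
      has_vector_derivative_matrix_mult has_vector_derivative_conj_transpose P_t [OF xt])+)
    (simp add: conj_transpose_reduce [OF xt])

text \<open>Since \<open>S\<close> is Hermitian, \<open>X0\<close> is \<open>\<i> J\<close> times a Hermitian matrix.\<close>

lemma X0_skew: "J ** (X0 x t)\<^sup>H ** J = - X0 x t"
proof -
  have "J ** (X0 x t)\<^sup>H ** J = - (\<i> *\<^sub>m (J ** (P x t)\<^sup>H ** matrix_inv (S x t) ** P x t ** (J ** J)))"
    by (simp add: X0_def B_def C_def conj_transpose_simps matrix_algebra_simps J_conj_transpose inv_S_hermitian)
  then show ?thesis
    by (simp add: J_square X0_def B_def C_def)
qed

lemma q'_eq: "q' x t = q x t - (q1 ** X0 x t - X0 x t ** q1)"
  by (simp add: q_potential_dressed [OF X0_skew] v'_eq)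

lemma XY_inverse: "(mat 1 - X x t) ** (mat 1 + Y x t) = mat 1" "(mat 1 + Y x t) ** (mat 1 - X x t) = mat 1"
  using darboux_factor_inverse(2,3) [OF S A AH sylvester'] by (simp_all add: Xm1_eq Ym1_eq B_def)

lemma Q'_intertwine: "Q' x t ** (mat 1 - X x t) = (mat 1 - X x t) ** Q x t"
proof -
  have "Q' x t ** (mat 1 - X x t) = (mat 1 - X x t) ** Q x t ** ((mat 1 + Y x t) ** (mat 1 - X x t))"
    by (simp only: Q'_eq matrix_mul_assoc)
  then show ?thesis by (simp add: XY_inverse)
qed

lemma J_conj_transpose_X: "J ** (mat 1 - X x t)\<^sup>H ** J = mat 1 + Y x t"
proof -
  have "J ** (X x t)\<^sup>H ** J = - (\<i> *\<^sub>m (C x t ** matrix_inv (A\<^sup>H) ** matrix_inv (S x t) ** P x t ** (J ** J)))"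
    by (simp add: Xm1_eq B_def C_def conj_transpose_simps matrix_algebra_simps J_conj_transpose
        inv_S_hermitian conj_transpose_matrix_inv(1) [OF A])
  then show ?thesis
    by (simp add: conj_transpose_simps conj_transpose_mat matrix_algebra_simps J_square Ym1_eq)
qed

text \<open>The symmetry of \<open>Q\<close> survives the conjugation because \<open>J (1 - X)\<^sup>H J\<close> is the inverse
  \<open>1 + Y\<close> of \<open>1 - X\<close>.\<close>

lemma Q'_skew: "J ** (Q' x t)\<^sup>H ** J = - Q' x t"
proof -
  have "(J ** (mat 1 - X x t)\<^sup>H ** J)\<^sup>H = (mat 1 + Y x t)\<^sup>H"
    by (simp only: J_conj_transpose_X)
  then have "(mat 1 + Y x t)\<^sup>H = J ** (mat 1 - X x t) ** J"
    by (simp add: conj_transpose_simps J_conj_transpose matrix_mul_assoc)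
  then have "J ** (Q' x t)\<^sup>H ** J = J ** J ** (mat 1 - X x t) ** (J ** (Q x t)\<^sup>H) ** ((mat 1 - X x t)\<^sup>H ** J)"
    by (simp only: Q'_eq conj_transpose_simps matrix_mul_assoc)
  also have "\<dots> = - ((mat 1 - X x t) ** Q x t ** (J ** (mat 1 - X x t)\<^sup>H ** J))"
    by (simp only: J_square J_Q_potential [OF \<rho>_real [OF xt]] matrix_mul_lid matrix_mul_assoc
        matrix_mult_add_diff_minus(4,5))
  also have "\<dots> = - Q' x t"
    by (simp only: J_conj_transpose_X Q'_eq)
  finally show ?thesis .
qed

lemma Q'_trace: "Q' x t $ 1 $ 1 + Q' x t $ 2 $ 2 = 0"
proof -
  have "trace (Q' x t) = trace ((mat 1 + Y x t) ** ((mat 1 - X x t) ** Q x t))"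
    by (simp only: Q'_eq trace_mul_sym [of _ "mat 1 + Y x t"])
  also have "\<dots> = trace (Q x t)"
    by (simp only: matrix_mul_assoc XY_inverse matrix_mul_lid)
  finally show ?thesis by (simp add: trace_def sum_2)
qed

lemma \<rho>'_real: "cnj (\<rho>' x t) = \<rho>' x t"
  using J_skew_nth(2) [OF Q'_skew] by (simp add: rho_transformed_def)

lemma B_x: "((\<lambda>s. B s t) has_vector_derivative - (q1 ** B x t ** A) - q' x t ** B x t) (at x)"
  unfolding q'_eq B_def [abs_def]
proof (rule has_vector_derivative_eq_rhs
    [OF has_vector_derivative_matrix_mult [OF C_x has_vector_derivative_matrix_inv [OF S_x [OF xt] S]]])
qed (use dressing_x_identity [OF S sylvester' refl refl, of q1 "q x t"] in
     \<open>simp add: X0_def B_def C_def matrix_mul_assoc add.commute\<close>)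

lemma B_t: "((\<lambda>s. B x s) has_vector_derivative - (Q' x t ** B x t ** matrix_inv A)) (at t)"
  unfolding B_def [abs_def]
proof (rule has_vector_derivative_eq_rhs
    [OF has_vector_derivative_matrix_mult [OF C_t has_vector_derivative_matrix_inv [OF S_t [OF xt] S]]])
qed (use dressing_t_identity [OF S A AH sylvester' B_def Xm1_eq Ym1_eq Q'_eq] in
     \<open>simp add: B_def C_def matrix_mul_assoc add.commute\<close>)

lemma X0_x_differentiable: "(\<lambda>s. X0 s t) differentiable (at x)"
  unfolding X0_def [abs_def]
  by (rule differentiableI_vector [OF has_vector_derivative_cscale
      [OF has_vector_derivative_matrix_mult [OF B_x P_x [OF xt]]]])

text \<open>The product rule gives \<open>X Q - Q' X\<close>, which equals \<open>Q - Q'\<close> by intertwining.\<close>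

lemma X0_t: "((\<lambda>s. X0 x s) has_vector_derivative Q x t - Q' x t) (at t)"
  unfolding X0_def [abs_def]
proof (rule has_vector_derivative_eq_rhs [OF has_vector_derivative_cscale
      [OF has_vector_derivative_matrix_mult [OF B_t P_t [OF xt]]]])
qed (use Q'_intertwine in \<open>simp add: Xm1_eq matrix_algebra_simps algebra_simps\<close>)

lemma v'_t: "((\<lambda>s. v' x s) has_vector_derivative - Q' x t $ 1 $ 2) (at t)"
proof -
  have "((\<lambda>s. v x s + X0 x s $ 1 $ 2) has_vector_derivative dt v x t + (Q x t - Q' x t) $ 1 $ 2) (at t)"
    by (intro has_vector_derivative_add v_t xt
        bounded_linear.has_vector_derivative [OF bounded_linear_vec_nth] X0_t)
  then show ?thesis by (simp add: v'_eq)
qed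

lemma dt_v': "dt v' x t = - Q' x t $ 1 $ 2"
  unfolding dt_def by (rule vector_derivative_at [OF v'_t])

lemma Q'_potential: "Q' x t = Q_potential p (\<rho>' x t) (dt v' x t)"
  using Q_potential_of_J_skew [OF Q'_skew Q'_trace] by (simp add: dt_v' rho_transformed_def)

lemma W_x:
  assumes "invertible (A - mat lam)"
  shows "((\<lambda>s. W lam s t) has_vector_derivative
    W lam x t ** (lam *\<^sub>m q1 + q x t) - (lam *\<^sub>m q1 + q' x t) ** W lam x t) (at x)"
proof -
  let ?R = "matrix_inv (A - mat lam)"
  note R = matrix_inv_cancel(2,1) [OF assms]
  have "((\<lambda>s. mat 1 - \<i> *\<^sub>m (B s t ** ?R ** P s t)) has_vector_derivative
      0 - \<i> *\<^sub>m (B x t ** ?R ** (A ** P x t ** q1 + P x t ** q x t)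
        + (B x t ** 0 + (- (q1 ** B x t ** A) - q' x t ** B x t) ** ?R) ** P x t)) (at x)"
    by (rule has_vector_derivative_diff has_vector_derivative_const has_vector_derivative_cscale
        has_vector_derivative_matrix_mult B_x P_x [OF xt])+
  moreover have "0 - \<i> *\<^sub>m (B x t ** ?R ** (A ** P x t ** q1 + P x t ** q x t)
        + (B x t ** 0 + (- (q1 ** B x t ** A) - q' x t ** B x t) ** ?R) ** P x t)
      = W lam x t ** (lam *\<^sub>m q1 + q x t) - (lam *\<^sub>m q1 + q' x t) ** W lam x t"
    using darboux_x_identity [OF R X0_def W_eq q'_eq]
    by (simp add: matrix_mult_add_diff_minus(5,6) add.commute)
  ultimately show ?thesis by (simp only: W_eq [abs_def])
qed

lemma W_t:
  assumes "invertible (A - mat lam)" and "lam \<noteq> 0"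
  shows "((\<lambda>s. W lam x s) has_vector_derivative
    (1 / lam) *\<^sub>m (W lam x t ** Q x t - Q' x t ** W lam x t)) (at t)"
proof -
  let ?R = "matrix_inv (A - mat lam)"
  note R = matrix_inv_cancel(2,1) [OF assms(1)]
  have "((\<lambda>s. mat 1 - \<i> *\<^sub>m (B x s ** ?R ** P x s)) has_vector_derivative
      0 - \<i> *\<^sub>m (B x t ** ?R ** (matrix_inv A ** P x t ** Q x t)
        + (B x t ** 0 + (- (Q' x t ** B x t ** matrix_inv A)) ** ?R) ** P x t)) (at t)"
    by (rule has_vector_derivative_diff has_vector_derivative_const has_vector_derivative_cscale
        has_vector_derivative_matrix_mult B_t P_t [OF xt])+
  moreover have "0 - \<i> *\<^sub>m (B x t ** ?R ** (matrix_inv A ** P x t ** Q x t)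
        + (B x t ** 0 + (- (Q' x t ** B x t ** matrix_inv A)) ** ?R) ** P x t)
      = (1 / lam) *\<^sub>m (W lam x t ** Q x t - Q' x t ** W lam x t)"
    using darboux_t_identity [OF R A Xm1_eq W_eq assms(2) Q'_intertwine]
    by (simp add: matrix_mult_add_diff_minus(5,6) add.commute)
  ultimately show ?thesis by (simp only: W_eq [abs_def])
qed

lemma W_inverse:
  assumes "invertible (A - mat lam)" and "invertible (A\<^sup>H - mat lam)"
  shows "invertible (W lam x t)"
proof -
  have "(A - mat lam) ** S x t - S x t ** (A\<^sup>H - mat lam) = \<i> *\<^sub>m (P x t ** C x t)"
    using sylvester' by (simp add: matrix_algebra_simps mat_mult_cscale)
  from darboux_factor_inverse(2,3) [OF S assms this] show ?thesis
    unfolding invertible_def W_eq B_def by blast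
qed

lemma eventually_S_invertible: "\<forall>\<^sub>F s in nhds x. s \<in> I \<and> invertible (S s t)"
proof -
  have "((\<lambda>s. S s t) \<longlongrightarrow> S x t) (at x)"
    using has_vector_derivative_continuous [OF S_x [OF xt]] by (simp add: isCont_def)
  then have "\<forall>\<^sub>F s in nhds x. invertible (S s t)"
    using eventually_invertible S by (auto simp: eventually_nhds_conv_at)
  moreover have "\<forall>\<^sub>F s in nhds x. s \<in> I"
    using I(1) xt(1) by (rule eventually_nhds_in_open)
  ultimately show ?thesis by (simp add: eventually_conj_iff)
qed

end

context
  fixes x t assumes xt: "x \<in> I" "t \<in> T" and S: "invertible (S x t)"
begin

text \<open>The factor \<open>1 - X\<close> is the Darboux matrix at \<open>\<lambda> = 0\<close>, so the \<open>x\<close>-equation of the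
  latter applies to it. Near \<open>x\<close> the matrix \<open>S\<close> stays invertible and \<open>1 + Y\<close> is the inverse of
  \<open>1 - X\<close>.\<close>

lemma Q'_x: "((\<lambda>s. Q' s t) has_vector_derivative Q' x t ** q' x t - q' x t ** Q' x t) (at x)"
proof -
  let ?T = "\<lambda>s. mat 1 - X s t"
  have A0: "invertible (A - mat 0)" using A by simp
  have T_x: "(?T has_vector_derivative ?T x ** q x t - q' x t ** ?T x) (at x)"
    using W_x [OF xt S A0] by (simp add: W_zero mat_mult_cscale flip: mat_mult_cscale(1))
  have inv: "matrix_inv (?T s) = mat 1 + Y s t" if "s \<in> I" "invertible (S s t)" for s
    by (rule matrix_inv_unique [OF XY_inverse(1) [OF that(1) xt(2) that(2)]])
  have T: "invertible (?T x)"
    using XY_inverse [OF xt S] unfolding invertible_def by blast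
  have "((\<lambda>s. ?T s ** Q s t ** matrix_inv (?T s)) has_vector_derivative
      Q' x t ** q' x t - q' x t ** Q' x t) (at x)"
  proof (rule has_vector_derivative_eq_rhs [OF has_vector_derivative_matrix_mult
        [OF has_vector_derivative_matrix_mult [OF T_x Q_x [OF xt]] has_vector_derivative_matrix_inv [OF T_x T]]])
    show "?T x ** Q x t ** - (matrix_inv (?T x) ** (?T x ** q x t - q' x t ** ?T x) ** matrix_inv (?T x))
        + (?T x ** (Q x t ** q x t - q x t ** Q x t) + (?T x ** q x t - q' x t ** ?T x) ** Q x t)
          ** matrix_inv (?T x)
      = Q' x t ** q' x t - q' x t ** Q' x t"
      unfolding inv [OF xt(1) S] Q'_eq
      by (rule conjugation_derivative_identity [OF XY_inverse [OF xt S]])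
  qed
  then show ?thesis
  proof (rule has_vector_derivative_cong_ev [THEN iffD1, rotated 2])
    show "\<forall>\<^sub>F s in nhds x. s \<in> UNIV \<longrightarrow> ?T s ** Q s t ** matrix_inv (?T s) = Q' s t"
      using eventually_S_invertible [OF xt S] by eventually_elim (simp add: inv Q'_eq)
    show "?T x ** Q x t ** matrix_inv (?T x) = Q' x t"
      by (simp add: inv [OF xt(1) S] Q'_eq)
  qed
qed

lemma Q'_x_potential:
  "((\<lambda>s. Q' s t) has_vector_derivative
    Q_potential p (of_real (- \<kappa> * Re (cnj (v' x t) * dt v' x t))) (\<rho>' x t * v' x t)) (at x)"
  using Q'_x Q_potential_commutator [OF \<rho>'_real [OF xt S], of "dt v' x t" "v' x t"]
  by (simp only: Q'_potential [OF xt S, symmetric])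

lemma \<rho>'_x: "((\<lambda>s. \<rho>' s t) has_vector_derivative
    of_real (- \<kappa> * Re (cnj (v' x t) * dt v' x t))) (at x)"
proof (rule has_vector_derivative_eq_rhs)
  show "((\<lambda>s. \<rho>' s t) has_vector_derivative \<i> * Q_potential p
      (of_real (- \<kappa> * Re (cnj (v' x t) * dt v' x t))) (\<rho>' x t * v' x t) $ 2 $ 2) (at x)"
    unfolding rho_transformed_def [of p \<rho> v A P S]
    by (intro has_vector_derivative_mult_right
        bounded_linear.has_vector_derivative [OF bounded_linear_vec_nth])
       (use Q'_x_potential in \<open>simp add: rho_transformed_def\<close>)
qed simp

lemma v'_tx: "((\<lambda>s. dt v' s t) has_vector_derivative \<rho>' x t * v' x t) (at x)"
proof -
  have "((\<lambda>s. - Q' s t $ 1 $ 2) has_vector_derivative - Q_potential p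
      (of_real (- \<kappa> * Re (cnj (v' x t) * dt v' x t))) (\<rho>' x t * v' x t) $ 1 $ 2) (at x)"
    by (intro has_vector_derivative_minus Q'_x_potential
        bounded_linear.has_vector_derivative [OF bounded_linear_vec_nth])
  then have "((\<lambda>s. - Q' s t $ 1 $ 2) has_vector_derivative \<rho>' x t * v' x t) (at x)"
    by simp
  then show ?thesis
  proof (rule has_vector_derivative_cong_ev [THEN iffD1, rotated 2])
    show "\<forall>\<^sub>F s in nhds x. s \<in> UNIV \<longrightarrow> - Q' s t $ 1 $ 2 = dt v' s t"
      using eventually_S_invertible [OF xt S] by eventually_elim (simp add: dt_v' xt)
    show "- Q' x t $ 1 $ 2 = dt v' x t" by (simp add: dt_v' [OF xt S])
  qed
qed

lemma isCont_Q'_t: "isCont (\<lambda>s. Q' x s) t"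
proof -
  have P: "((\<lambda>s. P x s) \<longlongrightarrow> P x t) (at t)" and "((\<lambda>s. S x s) \<longlongrightarrow> S x t) (at t)"
    using has_vector_derivative_continuous [OF P_t [OF xt]] has_vector_derivative_continuous [OF S_t [OF xt]]
    by (simp_all add: isCont_def)
  then have S: "((\<lambda>s. matrix_inv (S x s)) \<longlongrightarrow> matrix_inv (S x t)) (at t)"
    by (intro tendsto_matrix_inv S)
  have "isCont (\<lambda>s. Q x s) t"
    using continuous_on_product_sections(2) [OF continuous_Q xt(1)] T(1) xt(2)
    by (simp add: continuous_on_eq_continuous_at)
  then have Q: "((\<lambda>s. Q x s) \<longlongrightarrow> Q x t) (at t)" by (simp add: isCont_def)
  note tendsto = tendsto_const tendsto_add tendsto_diff
    bounded_linear.tendsto [OF bounded_linear_cscale]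
    bounded_bilinear.tendsto [OF bounded_bilinear_matrix_mult]
    bounded_linear.tendsto [OF bounded_linear_conj_transpose]
  show ?thesis
    unfolding isCont_def Q'_eq Xm1_def Ym1_def
    by (rule tendsto P S Q)+
qed

end

abbreviation \<Omega> where "\<Omega> \<equiv> {(x, t) \<in> I \<times> T. invertible (S x t)}"

theorem transformed_ccd_solution: "ccd_solution \<kappa> \<Omega> \<rho>' v'"
  unfolding ccd_solution_def
proof (clarify, intro conjI)
  fix x t assume xt: "x \<in> I" "t \<in> T" and S: "invertible (S x t)"
  note square = has_vector_derivative_cmod_square [OF v'_t [OF xt S]]
  show "(\<lambda>s. \<rho>' s t) differentiable at x" by (rule differentiableI_vector [OF \<rho>'_x [OF xt S]])
  show "(\<lambda>s. (cmod (v' x s))\<^sup>2) differentiable at t" by (rule differentiableI_vector [OF square])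
  show "(\<lambda>s. v' x s) differentiable at t" by (rule differentiableI_vector [OF v'_t [OF xt S]])
  show "(\<lambda>s. dt v' s t) differentiable at x" by (rule differentiableI_vector [OF v'_tx [OF xt S]])
  have "dt (\<lambda>x t. (cmod (v' x t))\<^sup>2) x t = 2 * Re (cnj (v' x t) * dt v' x t)"
    unfolding dt_def [of "\<lambda>x t. (cmod (v' x t))\<^sup>2"] vector_derivative_at [OF square]
    by (simp add: dt_v' [OF xt S])
  moreover have "dx \<rho>' x t = of_real (- \<kappa> * Re (cnj (v' x t) * dt v' x t))"
    unfolding dx_def by (rule vector_derivative_at [OF \<rho>'_x [OF xt S]])
  ultimately show "dx \<rho>' x t + of_real (\<kappa> / 2 * dt (\<lambda>x t. (cmod (v' x t))\<^sup>2) x t) = 0"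
    by (simp only: flip: of_real_add) simp
  show "dx (dt v') x t = \<rho>' x t * v' x t"
    unfolding dx_def by (rule vector_derivative_at [OF v'_tx [OF xt S]])
  show "\<rho>' x t = cnj (\<rho>' x t)" by (simp add: \<rho>'_real [OF xt S])
qed

lemma transformed_coefficients:
  assumes "x \<in> I" "t \<in> T" "invertible (S x t)"
  shows "Gmat p lam v' x t = - (lam *\<^sub>m q1 + q' x t)"
    and "Fmat p lam \<rho>' v' x t = - ((1 / lam) *\<^sub>m Q' x t)"
  by (simp_all add: coefficient_matrices Q'_potential [OF assms])

theorem darboux_wave_function:
  assumes lam: "lam \<noteq> 0" and inv: "invertible (A - mat lam)" "invertible (A\<^sup>H - mat lam)"
    and w: "wave_function p lam (I \<times> T) \<rho> v w"
  shows "wave_function p lam \<Omega> \<rho>' v' (\<lambda>x t. W lam x t ** w x t)"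
  unfolding wave_function_def
proof (intro conjI)
  show "(0, 0) \<in> \<Omega>" using I T invertible0 by simp
  show "det (W lam 0 0 ** w 0 0) \<noteq> 0"
    using W_inverse [OF I(3) T(3) invertible0 inv] w
    by (simp add: det_mul invertible_det_nz wave_function_def)
  show "\<forall>(x, t)\<in>\<Omega>.
      ((\<lambda>s. W lam s t ** w s t) has_vector_derivative Gmat p lam v' x t ** (W lam x t ** w x t)) (at x) \<and>
      ((\<lambda>s. W lam x s ** w x s) has_vector_derivative Fmat p lam \<rho>' v' x t ** (W lam x t ** w x t)) (at t)"
  proof (clarify, intro conjI)
    fix x t assume xt: "x \<in> I" "t \<in> T" and S: "invertible (S x t)"
    have wx: "((\<lambda>s. w s t) has_vector_derivative - (lam *\<^sub>m q1 + q x t) ** w x t) (at x)"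
      and wt: "((\<lambda>s. w x s) has_vector_derivative - ((1 / lam) *\<^sub>m Q x t) ** w x t) (at t)"
      using w xt by (auto simp: wave_function_def coefficient_matrices)
    show "((\<lambda>s. W lam s t ** w s t) has_vector_derivative Gmat p lam v' x t ** (W lam x t ** w x t)) (at x)"
      by (rule has_vector_derivative_eq_rhs
          [OF has_vector_derivative_matrix_mult [OF W_x [OF xt S inv(1)] wx]])
         (simp add: transformed_coefficients [OF xt S] matrix_algebra_simps algebra_simps)
    show "((\<lambda>s. W lam x s ** w x s) has_vector_derivative Fmat p lam \<rho>' v' x t ** (W lam x t ** w x t)) (at t)"
      by (rule has_vector_derivative_eq_rhs
          [OF has_vector_derivative_matrix_mult [OF W_t [OF xt S inv(1) lam] wt]])
         (simp add: transformed_coefficients [OF xt S] matrix_algebra_simps algebra_simps)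
  qed
qed

text \<open>The initial value of \<open>w\<close> is forced to be \<open>W\<inverse> w'\<close> at the origin.\<close>

theorem transformed_wave_function_factors:
  assumes lam: "lam \<noteq> 0" and inv: "invertible (A - mat lam)" "invertible (A\<^sup>H - mat lam)"
    and U: "open U" "connected U" "U \<subseteq> \<Omega>" and w': "wave_function p lam U \<rho>' v' w'"
  obtains w where "wave_function p lam (I \<times> T) \<rho> v w"
    and "\<And>x t. (x, t) \<in> U \<Longrightarrow> w' x t = W lam x t ** w x t"
proof -
  have U0: "(0, 0) \<in> U" and det0: "det (w' 0 0) \<noteq> 0" using w' by (simp_all add: wave_function_def)
  have W0: "invertible (W lam 0 0)" by (rule W_inverse [OF I(3) T(3) invertible0 inv])
  have "det (W lam 0 0 ** (matrix_inv (W lam 0 0) ** w' 0 0)) \<noteq> 0"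
    by (simp add: matrix_mul_assoc matrix_inv_cancel [OF W0] det0)
  then have "det (matrix_inv (W lam 0 0) ** w' 0 0) \<noteq> 0" by (simp add: det_mul)
  then obtain w where w: "wave_function p lam (I \<times> T) \<rho> v w"
    and w0: "w 0 0 = matrix_inv (W lam 0 0) ** w' 0 0"
    using wave_function_exists [OF lam] by blast
  note Ww = darboux_wave_function [OF lam inv w]
  show thesis
  proof (rule that [OF w])
    fix x t assume "(x, t) \<in> U"
    show "w' x t = W lam x t ** w x t"
    proof (rule matrix_pde_unique_on_connected [OF U(1,2) U0 \<open>(x, t) \<in> U\<close>, where
          G = "\<lambda>x t. - (lam *\<^sub>m q1 + q' x t)" and F = "\<lambda>x t. - ((1 / lam) *\<^sub>m Q' x t)"])
      fix x t assume xtU: "(x, t) \<in> U"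
      then have xt: "x \<in> I" "t \<in> T" and S: "invertible (S x t)" using U(3) by auto
      note coeff = transformed_coefficients [OF xt S, symmetric]
      have "isCont (\<lambda>s. v s t) x"
        using continuous_on_product_sections(1) [OF cont_v xt(2)] I(1) xt(1)
        by (simp add: continuous_on_eq_continuous_at)
      moreover have "isCont (\<lambda>s. X0 s t) x"
        using X0_x_differentiable [OF xt S] by (rule differentiable_imp_continuous_within)
      ultimately have "isCont (\<lambda>s. v' s t) x"
        unfolding v'_eq by (intro continuous_intros)
      then have "isCont (\<lambda>s. q' s t) x"
        by (rule bounded_linear.isCont [OF linear_q_potential])
      then show "isCont (\<lambda>s. - (lam *\<^sub>m q1 + q' s t)) x" by (intro continuous_intros)
      show "isCont (\<lambda>s. - ((1 / lam) *\<^sub>m Q' x s)) t"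
        by (intro continuous_minus bounded_linear.isCont [OF bounded_linear_cscale] isCont_Q'_t [OF xt S])
      show "((\<lambda>s. w' s t) has_vector_derivative - (lam *\<^sub>m q1 + q' x t) ** w' x t) (at x)"
        "((\<lambda>s. w' x s) has_vector_derivative - ((1 / lam) *\<^sub>m Q' x t) ** w' x t) (at t)"
        using w' xtU unfolding coeff by (auto simp: wave_function_def)
      show "((\<lambda>s. W lam s t ** w s t) has_vector_derivative
          - (lam *\<^sub>m q1 + q' x t) ** (W lam x t ** w x t)) (at x)"
        "((\<lambda>s. W lam x s ** w x s) has_vector_derivative
          - ((1 / lam) *\<^sub>m Q' x t) ** (W lam x t ** w x t)) (at t)"
        using Ww xt S unfolding coeff by (auto simp: wave_function_def)
    next
      show "w' 0 0 = W lam 0 0 ** w 0 0"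
        by (simp add: w0 matrix_mul_assoc matrix_inv_cancel [OF W0])
    qed
  qed
qed

end

lemma open_box_eq_Times:
  "open_box a1 a2 b1 b2 = {x. a1 < ereal x \<and> ereal x < a2} \<times> {t. b1 < ereal t \<and> ereal t < b2}"
  by (auto simp: open_box_def)

lemma open_interval_of_ereal:
  "open {x. a < ereal x \<and> ereal x < b}" "is_interval {x. a < ereal x \<and> ereal x < b}"
proof -
  have "open (ereal -` {a<..<b})" by (intro open_vimage continuous_intros)
  then show "open {x. a < ereal x \<and> ereal x < b}" by (simp add: vimage_def)
  show "is_interval {x. a < ereal x \<and> ereal x < b}"
    unfolding is_interval_1
  proof (intro ballI allI impI)
    fix y z x assume "y \<in> {x. a < ereal x \<and> ereal x < b}" "z \<in> {x. a < ereal x \<and> ereal x < b}"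
      and x: "y \<le> x \<and> x \<le> z"
    then have "a < ereal y" "ereal y \<le> ereal x" "ereal x \<le> ereal z" "ereal z < b" by auto
    then have "a < ereal x" "ereal x < b"
      by (blast intro: less_le_trans le_less_trans)+
    then show "x \<in> {x. a < ereal x \<and> ereal x < b}" by simp
  qed
qed

theorem corollary4p1:
  fixes a1 a2 b1 b2 :: ereal and \<kappa> :: real and p :: nat
    and \<rho> v :: "real \<Rightarrow> real \<Rightarrow> complex"
    and D :: "(real \<times> real) set"
    and A S0 :: "complex^'n^'n" and P0 :: "complex^2^'n"
  assumes "D = open_box a1 a2 b1 b2" and "a1 < 0" and "0 < a2" and "b1 < 0" and "0 < b2"
    and "\<kappa> \<in> {1, -1}" and "real p = (1 + \<kappa>) / 2"
    and "ccd_solution \<kappa> D \<rho> v"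
    and "continuous_on D (\<lambda>(x, t). dt v x t)"
    and "continuous_on D (\<lambda>(x, t). v x t)" and "continuous_on D (\<lambda>(x, t). \<rho> x t)"
    and "S0 = S0\<^sup>H" and "A ** S0 - S0 ** A\<^sup>H = \<i> *\<^sub>m (P0 ** jpow (p + 1) ** P0\<^sup>H)"
    and "det A \<noteq> 0" and "det S0 \<noteq> 0"
  shows
    "(\<exists>P S. linear_systems p D \<rho> v A P S \<and> P 0 0 = P0 \<and> S 0 0 = S0 \<and>
        (\<forall>P' S'. linear_systems p D \<rho> v A P' S' \<and> P' 0 0 = P0 \<and> S' 0 0 = S0 \<longrightarrow>
           (\<forall>(x, t) \<in> D. P' x t = P x t \<and> S' x t = S x t)))
     \<and>
     (\<forall>lam W0. lam \<noteq> 0 \<and> det W0 \<noteq> 0 \<longrightarrow>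
        (\<exists>w. wave_function p lam D \<rho> v w \<and> w 0 0 = W0 \<and>
           (\<forall>w'. wave_function p lam D \<rho> v w' \<and> w' 0 0 = W0 \<longrightarrow> (\<forall>(x, t) \<in> D. w' x t = w x t))))
     \<and>
     (\<forall>P S \<Omega> \<rho>' v'.
        linear_systems p D \<rho> v A P S \<and> P 0 0 = P0 \<and> S 0 0 = S0 \<and>
        \<Omega> = {(x, t) \<in> D. invertible (S x t)} \<and>
        \<rho>' = rho_transformed p \<rho> v A P S \<and> v' = v_transformed v P S \<longrightarrow>
        ccd_solution \<kappa> \<Omega> \<rho>' v' \<and>
        (\<forall>lam. lam \<notin> {0} \<union> spectrum A \<union> spectrum (A\<^sup>H) \<longrightarrow>
           (\<forall>w. wave_function p lam D \<rho> v w \<longrightarrow>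
              wave_function p lam \<Omega> \<rho>' v' (\<lambda>x t. darboux_matrix p A P S lam x t ** w x t)) \<and>
           (\<forall>U w'. open U \<and> connected U \<and> U \<subseteq> \<Omega> \<and> wave_function p lam U \<rho>' v' w' \<longrightarrow>
              (\<exists>w. wave_function p lam D \<rho> v w \<and>
                 (\<forall>(x, t) \<in> U. w' x t = darboux_matrix p A P S lam x t ** w x t)))))"
proof -
  define I T where "I = {x. a1 < ereal x \<and> ereal x < a2}" and "T = {t. b1 < ereal t \<and> ereal t < b2}"
  have D: "D = I \<times> T" using assms(1) by (simp add: I_def T_def open_box_eq_Times)
  interpret ccd_seed \<kappa> p I T \<rho> v
    by unfold_locales
       (use assms in \<open>simp_all add: D I_def T_def open_interval_of_ereal flip: zero_ereal_def\<close>)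
  have A: "invertible A" and S0: "invertible S0"
    using assms(14,15) by (simp_all add: invertible_det_nz)
  have 1: "\<exists>P S. linear_systems p D \<rho> v A P S \<and> P 0 0 = P0 \<and> S 0 0 = S0 \<and>
      (\<forall>P' S'. linear_systems p D \<rho> v A P' S' \<and> P' 0 0 = P0 \<and> S' 0 0 = S0 \<longrightarrow>
        (\<forall>(x, t) \<in> D. P' x t = P x t \<and> S' x t = S x t))"
  proof -
    obtain P S where PS: "linear_systems p (I \<times> T) \<rho> v A P S" "P 0 0 = P0" "S 0 0 = S0"
      using linear_systems_solvable [OF A] .
    show ?thesis
      unfolding D
    proof (intro exI [of _ P] exI [of _ S] conjI allI impI PS)
      fix P' S' assume "linear_systems p (I \<times> T) \<rho> v A P' S' \<and> P' 0 0 = P0 \<and> S' 0 0 = S0"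
      then have "P' x t = P x t \<and> S' x t = S x t" if "x \<in> I" "t \<in> T" for x t
        using linear_systems_unique [OF PS(1), of P' S' x t] PS that by simp
      then show "\<forall>(x, t) \<in> I \<times> T. P' x t = P x t \<and> S' x t = S x t" by blast
    qed
  qed
  have 2: "\<exists>w. wave_function p lam D \<rho> v w \<and> w 0 0 = W0 \<and>
      (\<forall>w'. wave_function p lam D \<rho> v w' \<and> w' 0 0 = W0 \<longrightarrow> (\<forall>(x, t) \<in> D. w' x t = w x t))"
    if "lam \<noteq> 0" "det W0 \<noteq> 0" for lam and W0 :: "complex^2^2"
  proof -
    obtain w where w: "wave_function p lam (I \<times> T) \<rho> v w" "w 0 0 = W0"
      using wave_function_exists [OF \<open>lam \<noteq> 0\<close> \<open>det W0 \<noteq> 0\<close>] .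
    show ?thesis
      unfolding D
    proof (intro exI [of _ w] conjI allI impI w)
      fix w' assume "wave_function p lam (I \<times> T) \<rho> v w' \<and> w' 0 0 = W0"
      then have "w' x t = w x t" if "x \<in> I" "t \<in> T" for x t
        using wave_function_unique [OF w(1), of w' x t] w that by simp
      then show "\<forall>(x, t) \<in> I \<times> T. w' x t = w x t" by blast
    qed
  qed
  have 3: "ccd_solution \<kappa> \<Omega> \<rho>' v' \<and>
      (\<forall>lam. lam \<notin> {0} \<union> spectrum A \<union> spectrum (A\<^sup>H) \<longrightarrow>
        (\<forall>w. wave_function p lam D \<rho> v w \<longrightarrow>
           wave_function p lam \<Omega> \<rho>' v' (\<lambda>x t. darboux_matrix p A P S lam x t ** w x t)) \<and>
        (\<forall>U w'. open U \<and> connected U \<and> U \<subseteq> \<Omega> \<and> wave_function p lam U \<rho>' v' w' \<longrightarrow>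
           (\<exists>w. wave_function p lam D \<rho> v w \<and>
              (\<forall>(x, t) \<in> U. w' x t = darboux_matrix p A P S lam x t ** w x t))))"
    if PS: "linear_systems p D \<rho> v A P S" "P 0 0 = P0" "S 0 0 = S0"
      and \<Omega>: "\<Omega> = {(x, t) \<in> D. invertible (S x t)}"
      and \<rho>': "\<rho>' = rho_transformed p \<rho> v A P S" and v': "v' = v_transformed v P S"
    for P S \<Omega> \<rho>' v'
  proof -
    interpret ccd_darboux \<kappa> p I T \<rho> v A P S
      by unfold_locales
         (use A S0 PS assms(12,13) in \<open>simp_all add: D flip: Suc_eq_plus1\<close>)
    have "ccd_solution \<kappa> \<Omega> \<rho>' v'"
      unfolding \<Omega> \<rho>' v' D by (rule transformed_ccd_solution)
    moreover have "wave_function p lam \<Omega> \<rho>' v' (\<lambda>x t. darboux_matrix p A P S lam x t ** w x t)"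
      if "lam \<notin> {0} \<union> spectrum A \<union> spectrum (A\<^sup>H)" "wave_function p lam D \<rho> v w" for lam w
      using that unfolding \<Omega> \<rho>' v' D
      by (intro darboux_wave_function) (auto simp: spectrum_def)
    moreover have "\<exists>w. wave_function p lam D \<rho> v w \<and>
        (\<forall>(x, t) \<in> U. w' x t = darboux_matrix p A P S lam x t ** w x t)"
      if lam: "lam \<notin> {0} \<union> spectrum A \<union> spectrum (A\<^sup>H)" and U: "open U" "connected U" "U \<subseteq> \<Omega>"
        and w': "wave_function p lam U \<rho>' v' w'" for lam U w'
    proof -
      have "lam \<noteq> 0" "invertible (A - mat lam)" "invertible (A\<^sup>H - mat lam)"
        using lam by (auto simp: spectrum_def)
      then obtain w where w: "wave_function p lam (I \<times> T) \<rho> v w"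
        and factor: "\<And>x t. (x, t) \<in> U \<Longrightarrow> w' x t = darboux_matrix p A P S lam x t ** w x t"
        by (rule transformed_wave_function_factors [OF _ _ _ U [unfolded \<Omega> D] w' [unfolded \<rho>' v']]) simp
      show ?thesis
        unfolding D using w factor by blast
    qed
    ultimately show ?thesis by simp
  qed
  show ?thesis
    by (rule conjI [OF 1], rule conjI)
       ((rule allI impI)+, erule conjE, rule 2, assumption+,
        (rule allI)+, rule impI, (erule conjE)+, rule 3, assumption+)
qed

end
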